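(* For each $X\in\{\mathrm A,\mathrm B\}$ let $j_1^X,j_2^X,j_3^X\in\tfrac12\mathbb Z_{\ge0}$ be such that $$\mathcal H_X=\operatorname{Inv}_{SU(2)}\big(\mathcal H_{j_1^X}\otimes\mathcal H_{j_2^X}\otimes\mathcal H_{j_3^X}\otimes\mathcal H_{1/2}\big)$$ is two-dimensional, and let $\operatorname{sgn}^X_{0}$, $\operatorname{sgn}^X_{1}$ be the sign operators on $\mathcal H_X$ of the fermion spin relative to the normals of the surfaces $S_0$, $S_1$. Put $A_i=\operatorname{sgn}^{\mathrm A}_{i}$ and $B_i=\operatorname{sgn}^{\mathrm B}_{i}$ for $i=0,1$, and consider the CHSH operator $$B=A_0\otimes B_0+A_0\otimes B_1+A_1\otimes B_0-A_1\otimes B_1\quad\text{on }\mathcal H_{\mathrm A}\otimes\mathcal H_{\mathrm B}.$$ With $J_i^X=j_i^X+\tfrac12$, let $\alpha_X$ be an angle with $$\cos\alpha_X=\frac{(J_1^X)^2+(J_2^X)^2-(J_3^X)^2}{2J_1^XJ_2^X}.$$ Then there exist eigenvectors of $B$ whose eigenvalue $\lambda$ satisfies $$|\lambda|=2\sqrt{1+|\sin\alpha_{\mathrm A}|\,|\sin\alpha_{\mathrm B}|}\;\ge 2 ,$$ and these states violate the Bell–CHSH inequality $|\langle B\rangle|\le2$, i.e. $|\langle B\rangle|=|\lambda|>2$ in the (normalized) eigenstate.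
   Context: $\mathcal H_j$ is the spin-$j$ irreducible representation of $SU(2)$. The physical setting is a pair of vertices $v_{\mathrm A},v_{\mathrm B}$ of a spin network in loop quantum gravity, each carrying one fermion (the spin-$\tfrac12$ factor). Through each vertex pass two surfaces $S_0,S_1$, which divide a neighbourhood of the vertex into four wedges. No edges are tangential to the surfaces, one wedge contains no edges, and the spins of the edges in the three other wedges are recoupled to fixed total spins $j_1,j_2,j_3$. The wedge with $j_1$ lies above both surfaces, the wedge with $j_2$ lies below both, and the wedge with $j_3$ lies above $S_0$ and below $S_1$. States of the fermion–geometry system at the vertex $v_X$ are described by intertwiners in $\mathcal H_X$. Sign operator: given a surface, couple all spins above it to a total spin $j^\uparrow$ and all spins below it to a total spin $j^\downarrow$. Invariance together with the fermion spin $\tfrac12$ forces $j^\downarrow=j^\uparrow+\tfrac p2$ with $p\in\{+1,-1\}$. The sign operator of the surface is the self-adjoint operator acting on intertwiners with definite $(j^\uparrow,j^\downarrow)$ as multiplication by $p$. (It is the sign of the cosine operator, which measures the normalized component of the fermion spin along the surface normal.) Concretely, on $\mathcal H_X$ (dropping the superscript $X$): - $\operatorname{sgn}_0$ (surface $S_0$): $\mathcal H_X$ has an orthonormal basis $|r\rangle_0$, $r=\pm1$, of intertwiners in which $j_1$ and $j_3$ are coupled to total spin $j_{13}=j_2+\tfrac r2$; here $j^\uparrow=j_{13}$, $j^\downarrow=j_2$, and $\operatorname{sgn}_0|r\rangle_0=-r|r\rangle_0$. - $\operatorname{sgn}_1$ (surface $S_1$): $\mathcal H_X$ has an orthonormal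 basis $|r\rangle_1$, $r=\pm1$, of intertwiners in which $j_2$ and $j_3$ are coupled to total spin $j_{23}=j_1+\tfrac r2$; here $j^\uparrow=j_1$, $j^\downarrow=j_{23}$, and $\operatorname{sgn}_1|r\rangle_1=r|r\rangle_1$. *)

theory Defs
  imports "HOL-Analysis.Analysis" "HOL-Library.Function_Algebras"
begin

text \<open>
  Spins are encoded by their doubles: a natural number \<open>n\<close> stands for the spin \<open>n/2\<close>.
  Vectors are complex-valued functions on an index set, with pointwise addition from
  \<^theory>\<open>HOL-Library.Function_Algebras\<close> and the following scalar multiplication.
\<close>

definition cscale :: "complex \<Rightarrow> ('a \<Rightarrow> complex) \<Rightarrow> 'a \<Rightarrow> complex" where
  "cscale c f = (\<lambda>x. c * f x)"

interpretation cfun: vector_space cscale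
  by unfold_locales (auto simp: cscale_def algebra_simps fun_eq_iff)

definition cinner :: "'a set \<Rightarrow> ('a \<Rightarrow> complex) \<Rightarrow> ('a \<Rightarrow> complex) \<Rightarrow> complex" where
  "cinner S f g = (\<Sum>x\<in>S. cnj (f x) * g x)"


section \<open>The spin representations of SU(2)\<close>

definition SU2 :: "(complex ^ 2 ^ 2) set" where
  "SU2 = {g. g ** transpose (\<chi> i j. cnj (g $ i $ j)) = mat 1 \<and> det g = 1}"

text \<open>
  The spin-\<open>n/2\<close> representation consists of the homogeneous polynomials \<open>P\<close> of degree \<open>n\<close> in
  \<open>(x, y)\<close>, with \<open>(g P)(x, y) = P((x, y) g)\<close>.  In the orthonormal basis
  \<open>e a = sqrt (n choose a) x^a y^(n - a)\<close>, \<open>a \<le> n\<close> (magnetic number \<open>a - n/2\<close>),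
  \<open>g (e a)\<close> is the sum of \<open>D n g b a * e b\<close> over \<open>b \<le> n\<close>.  The univariate polynomials below
  are the images of \<open>x\<close> and \<open>y\<close> at \<open>y = 1\<close>.
\<close>

definition D :: "nat \<Rightarrow> complex ^ 2 ^ 2 \<Rightarrow> nat \<Rightarrow> nat \<Rightarrow> complex" where
  "D n g b a = of_real (sqrt (real (n choose a) / real (n choose b))) *
     coeff ([:g $ 2 $ 1, g $ 1 $ 1:] ^ a * [:g $ 2 $ 2, g $ 1 $ 2:] ^ (n - a)) b"


section \<open>Tensor products of spin representations and intertwiners\<close>

text \<open>
  The legs at a vertex: the recoupled edges with spins \<open>j\<^sub>1\<close>, \<open>j\<^sub>2\<close>, \<open>j\<^sub>3\<close>, and the fermion.
  A map \<open>d :: leg \<Rightarrow> nat\<close> assigns to every leg its doubled spin.  The tensor product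
  of the spin representations over all legs consists of the functions of the magnetic
  indices that vanish outside \<open>configs d\<close>.
\<close>

datatype leg = Edge1 | Edge2 | Edge3 | Fermion

type_synonym state = "(leg \<Rightarrow> nat) \<Rightarrow> complex"

definition configs :: "(leg \<Rightarrow> nat) \<Rightarrow> (leg \<Rightarrow> nat) set" where
  "configs d = {m. \<forall>i. m i \<le> d i}"

definition states :: "(leg \<Rightarrow> nat) \<Rightarrow> state set" where
  "states d = {\<psi>. \<forall>m. m \<notin> configs d \<longrightarrow> \<psi> m = 0}"

text \<open>The group element \<open>g\<close> acting on the legs in \<open>U\<close> and trivially on the others.\<close>

definition act :: "(leg \<Rightarrow> nat) \<Rightarrow> leg set \<Rightarrow> complex ^ 2 ^ 2 \<Rightarrow> state \<Rightarrow> state" where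
  "act d U g \<psi> = (\<lambda>m. if m \<in> configs d
     then \<Sum>m' \<in> {m' \<in> configs d. \<forall>i. i \<notin> U \<longrightarrow> m' i = m i}.
            (\<Prod>i\<in>U. D (d i) g (m i) (m' i)) * \<psi> m'
     else 0)"

definition intertwiners :: "(leg \<Rightarrow> nat) \<Rightarrow> state set" where
  "intertwiners d = {\<psi> \<in> states d. \<forall>g\<in>SU2. act d UNIV g \<psi> = \<psi>}"


section \<open>Recoupling and sign operators\<close>

text \<open>
  An SU(2)-equivariant linear map from the spin-\<open>k/2\<close> representation to the states, on which
  the group acts through the legs in \<open>U\<close> only, is given by the images \<open>T a\<close> of the basis
  vectors \<open>e a\<close>.
\<close>

definition equivariant :: "(leg \<Rightarrow> nat) \<Rightarrow> leg set \<Rightarrow> nat \<Rightarrow> (nat \<Rightarrow> state) \<Rightarrow> bool" where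
  "equivariant d U k T \<longleftrightarrow> (\<forall>a\<le>k. T a \<in> states d) \<and>
     (\<forall>g\<in>SU2. \<forall>a\<le>k. act d U g (T a) = (\<Sum>b\<le>k. cscale (D k g b a) (T b)))"

text \<open>
  The states in which the legs in \<open>U\<close> are coupled to total spin \<open>k/2\<close>, i.e.\ the isotypic
  component of the spin-\<open>k/2\<close> representation under the action on the legs in \<open>U\<close>.
\<close>

definition coupled :: "(leg \<Rightarrow> nat) \<Rightarrow> leg set \<Rightarrow> nat \<Rightarrow> state set" where
  "coupled d U k = cfun.span {T a | T a. equivariant d U k T \<and> a \<le> k}"

datatype surface = S0 | S1

text \<open>
  The first edge lies above both surfaces, the second below both, and the third above
  \<open>S0\<close> and below \<open>S1\<close>.
\<close>

fun above :: "surface \<Rightarrow> leg set" where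
  "above S0 = {Edge1, Edge3}"
| "above S1 = {Edge1}"

fun below :: "surface \<Rightarrow> leg set" where
  "below S0 = {Edge2}"
| "below S1 = {Edge2, Edge3}"

text \<open>
  With \<open>u = 2 j\<^sup>\<up>\<close> and \<open>l = 2 j\<^sup>\<down>\<close>, the condition \<open>j\<^sup>\<down> = j\<^sup>\<up> + p/2\<close> reads \<open>l = u + p\<close>.
  An operator on the intertwiners is represented by a map that is zero elsewhere.
\<close>

definition is_sign_operator :: "(leg \<Rightarrow> nat) \<Rightarrow> surface \<Rightarrow> (state \<Rightarrow> state) \<Rightarrow> bool" where
  "is_sign_operator d S A \<longleftrightarrow>
     (\<forall>\<psi>\<in>intertwiners d. A \<psi> \<in> intertwiners d) \<and>
     (\<forall>\<psi>. \<psi> \<notin> intertwiners d \<longrightarrow> A \<psi> = 0) \<and>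
     (\<forall>\<phi>\<in>intertwiners d. \<forall>\<psi>\<in>intertwiners d. A (\<phi> + \<psi>) = A \<phi> + A \<psi>) \<and>
     (\<forall>c. \<forall>\<psi>\<in>intertwiners d. A (cscale c \<psi>) = cscale c (A \<psi>)) \<and>
     (\<forall>\<phi>\<in>intertwiners d. \<forall>\<psi>\<in>intertwiners d.
        cinner (configs d) \<phi> (A \<psi>) = cinner (configs d) (A \<phi>) \<psi>) \<and>
     (\<forall>u l. \<forall>p \<in> {1, -1 :: int}.
        \<forall>\<psi> \<in> intertwiners d \<inter> coupled d (above S) u \<inter> coupled d (below S) l.
          int l = int u + p \<longrightarrow> A \<psi> = cscale (of_int p) \<psi>)"

definition sign_operator :: "(leg \<Rightarrow> nat) \<Rightarrow> surface \<Rightarrow> state \<Rightarrow> state" where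
  "sign_operator d S = (THE A. is_sign_operator d S A)"


section \<open>Two vertices\<close>

definition product_state :: "('a \<Rightarrow> complex) \<Rightarrow> ('b \<Rightarrow> complex) \<Rightarrow> 'a \<times> 'b \<Rightarrow> complex" where
  "product_state \<psi> \<phi> = (\<lambda>(m, m'). \<psi> m * \<phi> m')"

definition tensor_space ::
    "('a \<Rightarrow> complex) set \<Rightarrow> ('b \<Rightarrow> complex) set \<Rightarrow> ('a \<times> 'b \<Rightarrow> complex) set" where
  "tensor_space V W = cfun.span {product_state \<psi> \<phi> | \<psi> \<phi>. \<psi> \<in> V \<and> \<phi> \<in> W}"

text \<open>\<open>Q\<close> acts on the second index, then \<open>P\<close> on the first.\<close>

definition tensor_op ::
    "(('a \<Rightarrow> complex) \<Rightarrow> 'a \<Rightarrow> complex) \<Rightarrow> (('b \<Rightarrow> complex) \<Rightarrow> 'b \<Rightarrow> complex) \<Rightarrow>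
     ('a \<times> 'b \<Rightarrow> complex) \<Rightarrow> 'a \<times> 'b \<Rightarrow> complex" where
  "tensor_op P Q \<Psi> = (\<lambda>(m, m'). P (\<lambda>k. Q (\<lambda>k'. \<Psi> (k, k')) m') m)"

lemma tensor_op_product_state:
  assumes "\<And>c. P (cscale c \<psi>) = cscale c (P \<psi>)" "\<And>c. Q (cscale c \<phi>) = cscale c (Q \<phi>)"
  shows "tensor_op P Q (product_state \<psi> \<phi>) = product_state (P \<psi>) (Q \<phi>)"
proof -
  have Q: "Q (\<lambda>k'. product_state \<psi> \<phi> (k, k')) m' = Q \<phi> m' * \<psi> k" for k m'
    using fun_cong[OF assms(2)[of "\<psi> k"], of m']
    by (simp add: cscale_def product_state_def mult.commute)
  have P: "P (\<lambda>k. Q \<phi> m' * \<psi> k) m = P \<psi> m * Q \<phi> m'" for m m'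
    using fun_cong[OF assms(1)[of "Q \<phi> m'"], of m] by (simp add: cscale_def mult.commute)
  show ?thesis
    unfolding tensor_op_def Q P by (simp add: product_state_def)
qed

definition chsh ::
    "(leg \<Rightarrow> nat) \<Rightarrow> (leg \<Rightarrow> nat) \<Rightarrow>
     ((leg \<Rightarrow> nat) \<times> (leg \<Rightarrow> nat) \<Rightarrow> complex) \<Rightarrow> (leg \<Rightarrow> nat) \<times> (leg \<Rightarrow> nat) \<Rightarrow> complex" where
  "chsh dA dB \<Psi> =
     tensor_op (sign_operator dA S0) (sign_operator dB S0) \<Psi>
     + tensor_op (sign_operator dA S0) (sign_operator dB S1) \<Psi>
     + tensor_op (sign_operator dA S1) (sign_operator dB S0) \<Psi>
     - tensor_op (sign_operator dA S1) (sign_operator dB S1) \<Psi>"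

definition chsh_eigenvector ::
    "(leg \<Rightarrow> nat) \<Rightarrow> (leg \<Rightarrow> nat) \<Rightarrow> complex \<Rightarrow>
     ((leg \<Rightarrow> nat) \<times> (leg \<Rightarrow> nat) \<Rightarrow> complex) \<Rightarrow> bool" where
  "chsh_eigenvector dA dB \<mu> \<Psi> \<longleftrightarrow>
     \<Psi> \<in> tensor_space (intertwiners dA) (intertwiners dB) \<and> \<Psi> \<noteq> 0 \<and>
     chsh dA dB \<Psi> = cscale \<mu> \<Psi>"

definition J :: "nat \<Rightarrow> real" where
  "J n = real n / 2 + 1 / 2"

end

(*
  The two sign operators have closed forms.  On invariant states the legs on one side of a surface
  carry the same total spin as the legs on the other side, so for both surfaces only the coupling of
  the fermion to a single edge e matters (e = 2 for S0, e = 1 for S1).  The Casimir operator of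
  that pair is J_e^2 + X_e with X_e = sigma . L_e + 1/2, where sigma are the Pauli matrices of the
  fermion, L_e is the spin of the edge and J_e = j_e + 1/2.  Hence X_e^2 = J_e^2,
  A_0 = - X_2 / J_2 and A_1 = X_1 / J_1.  The Casimir operator of the legs 1, 2 and the fermion equals
  that of leg 3, which turns into X_1 X_2 + X_2 X_1 = J_3^2 - J_1^2 - J_2^2, i.e.
  A_0 A_1 + A_1 A_0 = 2 cos alpha.  Two involutions with this relation generate a
  representation in which the CHSH operator is computed by hand.  A vanishing sin alpha would mean that
  one doubled spin is the sum of the other three, and then the intertwiner space is at most a line.

  The group and the Lie algebra are compared along the curves t |-> cos t + K sin t = exp (t K) with
  K^2 = -1, which cover SU(2); infinitesimal equivariance integrates to equivariance because the
  generators are antihermitian, so that the norm of the defect is constant.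
*)
theory Submission
  imports Defs
begin


section \<open>Matrices acting on the legs\<close>

text \<open>\<open>sign_operator\<close> is a definite description whose spectral information
  concerns only spans of equivariant families. That the closed form qualifies needs coupled vectors
  to be Casimir eigenvectors; its uniqueness needs the converse, that an eigenvector with the right
  Casimir value and parity is coupled. The converse is the heavier half: it rests on highest-weight
  ladders and on the passage from the Lie algebra back to the group. The anticommutator of two
  Casimir expressions takes the place of explicit recoupling coefficients. At each vertex there are
  \<phi> and \<eta> = A_0 \<phi> with A_1 \<phi> = \<omega> \<eta>. The CHSH operator exchanges
  \<phi> (x) \<phi>' and \<eta> (x) \<eta>' up to z = 1 + \<omega> + \<omega>' - \<omega> \<omega>'
  and its conjugate, so its eigenvalues there are |z| and -|z|. Taking imaginary part |sin \<alpha>|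
  for \<omega> at both vertices gives |z|^2 = 4 (1 + |sin \<alpha>A| |sin \<alpha>B|); opposite
  signs would give the smaller value with a minus.\<close>

lemma UNIV_leg: "UNIV = {Edge1, Edge2, Edge3, Fermion}"
  using leg.exhaust by auto

lemma finite_legs [simp]: "finite (U :: leg set)"
  by (rule finite_subset[OF subset_UNIV]) (simp add: UNIV_leg)

lemma finite_configs [simp]: "finite (configs d)"
proof -
  have "configs d = Pi\<^sub>E UNIV (\<lambda>i. {..d i})"
    by (auto simp: configs_def PiE_def Pi_def)
  then show ?thesis by (simp add: finite_PiE)
qed

lemma configs_upd: "m \<in> configs d \<Longrightarrow> c \<le> d i \<Longrightarrow> m(i := c) \<in> configs d"
  by (simp add: configs_def)

lemma configs_le: "m \<in> configs d \<Longrightarrow> m i \<le> d i"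
  by (simp add: configs_def)

lemma cscale_apply [simp]: "cscale c f x = c * f x"
  by (simp add: cscale_def)

lemma sum_fun_apply: "(sum f S) x = (\<Sum>i\<in>S. f i x)"
  by (induction S rule: infinite_finite_induct) auto

lemma states_subspace: "cfun.subspace (states d)"
  by (auto simp: cfun.subspace_def states_def)

lemma states_add: "\<phi> \<in> states d \<Longrightarrow> \<psi> \<in> states d \<Longrightarrow> \<phi> + \<psi> \<in> states d"
  and states_scale: "\<psi> \<in> states d \<Longrightarrow> cscale c \<psi> \<in> states d"
  and states_0: "0 \<in> states d"
  and states_sum: "(\<And>x. x \<in> X \<Longrightarrow> f x \<in> states d) \<Longrightarrow> sum f X \<in> states d"
  using states_subspace[of d]
  by (auto intro: cfun.subspace_add cfun.subspace_scale cfun.subspace_0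
      cfun.subspace_sum)

type_synonym family = "nat \<Rightarrow> nat \<Rightarrow> nat \<Rightarrow> complex"

text \<open>A family \<open>N\<close> consists of one matrix \<open>N n\<close>, with indices in \<open>{..n}\<close>, for every spin \<open>n/2\<close>.\<close>

definition legop :: "(leg \<Rightarrow> nat) \<Rightarrow> leg \<Rightarrow> family \<Rightarrow> state \<Rightarrow> state" where
  "legop d i N \<psi> = (\<lambda>m. if m i \<le> d i then \<Sum>c\<le>d i. N (d i) (m i) c * \<psi> (m(i := c)) else 0)"

text \<open>For Lie algebra matrices this is the derived representation of \<open>act d U\<close>, a
  component of the total spin of the legs in \<open>U\<close>; \<open>act_rot_derivative\<close>
  makes this precise.\<close>

definition tot :: "(leg \<Rightarrow> nat) \<Rightarrow> leg set \<Rightarrow> family \<Rightarrow> state \<Rightarrow> state" where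
  "tot d U N \<psi> = (\<Sum>i\<in>U. legop d i N \<psi>)"

definition fmul :: "family \<Rightarrow> family \<Rightarrow> family" where
  "fmul N N' n b c = (\<Sum>k\<le>n. N n b k * N' n k c)"

lemma legop_add: "legop d i N (\<phi> + \<psi>) = legop d i N \<phi> + legop d i N \<psi>"
  by (auto simp: legop_def fun_eq_iff algebra_simps sum.distrib)

lemma legop_diff: "legop d i N (\<phi> - \<psi>) = legop d i N \<phi> - legop d i N \<psi>"
  by (auto simp: legop_def fun_eq_iff algebra_simps sum_subtractf)

lemma legop_scale: "legop d i N (cscale c \<psi>) = cscale c (legop d i N \<psi>)"
  by (auto simp: legop_def fun_eq_iff sum_distrib_left mult_ac)

lemma legop_0: "legop d i N 0 = 0"
  by (auto simp: legop_def fun_eq_iff)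

lemma legop_sum: "legop d i N (sum f S) = (\<Sum>x\<in>S. legop d i N (f x))"
  by (induction S rule: infinite_finite_induct) (simp_all only: sum.infinite sum.empty sum.insert legop_0 legop_add not_False_eq_True)

lemma legop_states: "\<psi> \<in> states d \<Longrightarrow> legop d i N \<psi> \<in> states d"
proof -
  assume *: "\<psi> \<in> states d"
  {
    fix m assume m: "m \<notin> configs d" "m i \<le> d i"
    \<comment> \<open>Leg i is within its range, so another leg is out of range and stays so when
      the index of leg i changes.\<close>
    then obtain j where "m j > d j" "j \<noteq> i" by (force simp: configs_def not_le)
    then have "m(i := c) \<notin> configs d" for c
      by (auto simp: configs_def not_le intro!: exI[of _ j])
    then have "\<psi> (m(i := c)) = 0" for c using * by (auto simp: states_def)
  }
  then show ?thesis by (auto simp: states_def legop_def)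
qed

lemma legop_commute:
  assumes "i \<noteq> j"
  shows "legop d i N (legop d j N' \<psi>) = legop d j N' (legop d i N \<psi>)"
proof
  fix m
  have "(\<Sum>c\<le>d i. \<Sum>c'\<le>d j. N (d i) (m i) c * (N' (d j) (m j) c' * \<psi> (m(i := c, j := c')))) =
     (\<Sum>c\<le>d j. \<Sum>c'\<le>d i. N' (d j) (m j) c * (N (d i) (m i) c' * \<psi> (m(j := c, i := c'))))"
    by (subst sum.swap) (simp add: mult_ac fun_upd_twist[OF assms])
  then show "legop d i N (legop d j N' \<psi>) m = legop d j N' (legop d i N \<psi>) m"
    using assms by (simp add: legop_def sum_distrib_left)
qed

lemma legop_mult: "legop d i N (legop d i N' \<psi>) = legop d i (fmul N N') \<psi>"
proof
  fix m
  have "(\<Sum>c\<le>d i. \<Sum>c'\<le>d i. N (d i) (m i) c * (N' (d i) c c' * \<psi> (m(i := c')))) =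
     (\<Sum>c'\<le>d i. (\<Sum>c\<le>d i. N (d i) (m i) c * N' (d i) c c') * \<psi> (m(i := c')))"
    by (subst sum.swap) (simp add: sum_distrib_right sum_distrib_left mult_ac)
  then show "legop d i N (legop d i N' \<psi>) m = legop d i (fmul N N') \<psi> m"
    by (simp add: legop_def sum_distrib_left fmul_def)
qed

lemma legop_cong:
  assumes "\<And>b c. b \<le> d i \<Longrightarrow> c \<le> d i \<Longrightarrow> N (d i) b c = N' (d i) b c"
  shows "legop d i N \<psi> = legop d i N' \<psi>"
  by (auto simp: legop_def fun_eq_iff assms intro!: sum.cong)

lemma legop_family_add: "legop d i (\<lambda>n b c. N n b c + N' n b c) \<psi> = legop d i N \<psi> + legop d i N' \<psi>"
  by (auto simp: legop_def fun_eq_iff algebra_simps sum.distrib)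

lemma legop_family_scale: "legop d i (\<lambda>n b c. x * N n b c) \<psi> = cscale x (legop d i N \<psi>)"
  by (auto simp: legop_def fun_eq_iff sum_distrib_left mult_ac)

lemma legop_scalar:
  assumes "\<psi> \<in> states d"
  shows "legop d i (\<lambda>n b c. if b = c then x n else 0) \<psi> = cscale (x (d i)) \<psi>"
proof
  fix m
  show "legop d i (\<lambda>n b c. if b = c then x n else 0) \<psi> m = cscale (x (d i)) \<psi> m"
  proof (cases "m i \<le> d i")
    case True
    have "(\<Sum>c\<le>d i. (if m i = c then x (d i) else 0) * \<psi> (m(i := c))) =
      (\<Sum>c\<le>d i. if m i = c then x (d i) * \<psi> (m(i := c)) else 0)"
      by (rule sum.cong) auto
    then show ?thesis using True by (simp add: legop_def)
  next
    case False
    then have "m \<notin> configs d" by (auto simp: configs_def)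
    then show ?thesis using False assms by (auto simp: legop_def states_def)
  qed
qed

text \<open>The map (m, c) to (m(i := c), m i) is an involution exchanging the old and the new
  configuration. It serves for adjoints of \<open>legop\<close> and to shift a generator from the
  matrices of \<open>act\<close> onto the state.\<close>

lemma sum_configs_upd_swap:
  fixes F :: "(leg \<Rightarrow> nat) \<Rightarrow> (leg \<Rightarrow> nat) \<Rightarrow> complex"
  assumes "finite S" "\<And>m c. m \<in> S \<Longrightarrow> c \<le> n \<Longrightarrow> m(i := c) \<in> S" "\<And>m. m \<in> S \<Longrightarrow> m i \<le> n"
  shows "(\<Sum>m\<in>S. \<Sum>c\<le>n. F m (m(i := c))) = (\<Sum>m\<in>S. \<Sum>c\<le>n. F (m(i := c)) m)"
  unfolding sum.cartesian_product
  by (rule sum.reindex_bij_witness[where i = "\<lambda>(m, c). (m(i := c), m i)"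
        and j = "\<lambda>(m, c). (m(i := c), m i)"]) (auto simp: assms)

lemma cinner_legop:
  assumes "\<And>b c. b \<le> d i \<Longrightarrow> c \<le> d i \<Longrightarrow> N' (d i) b c = cnj (N (d i) c b)"
  shows "cinner (configs d) \<phi> (legop d i N \<psi>) = cinner (configs d) (legop d i N' \<phi>) \<psi>"
proof -
  have "cinner (configs d) \<phi> (legop d i N \<psi>) =
     (\<Sum>m\<in>configs d. \<Sum>c\<le>d i. cnj (\<phi> m) * N (d i) (m i) ((m(i := c)) i) * \<psi> (m(i := c)))"
    by (auto simp: cinner_def legop_def sum_distrib_left mult_ac configs_le intro!: sum.cong)
  also have "\<dots> = (\<Sum>m\<in>configs d. \<Sum>c\<le>d i. cnj (\<phi> (m(i := c))) * N (d i) ((m(i := c)) i) (m i) * \<psi> m)"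
    by (rule sum_configs_upd_swap) (auto simp: configs_upd configs_le)
  also have "\<dots> = cinner (configs d) (legop d i N' \<phi>) \<psi>"
    by (auto simp: cinner_def legop_def sum_distrib_left sum_distrib_right mult_ac configs_le assms
        intro!: sum.cong)
  finally show ?thesis .
qed

section \<open>Sums of leg operators and their commutators\<close>

lemma tot_add: "tot d U N (\<phi> + \<psi>) = tot d U N \<phi> + tot d U N \<psi>"
  by (simp add: tot_def legop_add sum.distrib)

lemma tot_diff: "tot d U N (\<phi> - \<psi>) = tot d U N \<phi> - tot d U N \<psi>"
  by (simp add: tot_def legop_diff sum_subtractf)

lemma tot_scale: "tot d U N (cscale c \<psi>) = cscale c (tot d U N \<psi>)"
  by (simp add: tot_def legop_scale cfun.scale_sum_right)

lemma tot_0: "tot d U N 0 = 0"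
  by (simp add: tot_def legop_0)

lemma tot_sum: "tot d U N (sum f S) = (\<Sum>x\<in>S. tot d U N (f x))"
  by (induction S rule: infinite_finite_induct) (simp_all only: sum.infinite sum.empty sum.insert tot_0 tot_add not_False_eq_True)

lemma tot_states: "\<psi> \<in> states d \<Longrightarrow> tot d U N \<psi> \<in> states d"
  unfolding tot_def by (intro states_sum legop_states)

lemma tot_family_add: "tot d U (\<lambda>n b c. N n b c + N' n b c) \<psi> = tot d U N \<psi> + tot d U N' \<psi>"
  by (simp add: tot_def legop_family_add sum.distrib)

lemma tot_family_scale: "tot d U (\<lambda>n b c. x * N n b c) \<psi> = cscale x (tot d U N \<psi>)"
  by (simp add: tot_def legop_family_scale cfun.scale_sum_right)

text \<open>Matrices on different legs commute, so only terms with both operators on the same leg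
  contribute; hence the totals obey the relations of the single matrices.\<close>

lemma tot_commutator:
  assumes "\<And>n b c. b \<le> n \<Longrightarrow> c \<le> n \<Longrightarrow> fmul N N' n b c = fmul N' N n b c + x * K n b c"
  shows "tot d U N (tot d U N' \<psi>) = tot d U N' (tot d U N \<psi>) + cscale x (tot d U K \<psi>)"
proof -
  have *: "legop d i N (legop d j N' \<psi>) =
     legop d j N' (legop d i N \<psi>) + (if i = j then cscale x (legop d i K \<psi>) else 0)" for i j
  proof (cases "i = j")
    case True
    have "legop d i (fmul N N') \<psi> = legop d i (\<lambda>n b c. fmul N' N n b c + x * K n b c) \<psi>"
      by (rule legop_cong) (rule assms)
    then show ?thesis
      by (simp add: True legop_mult legop_family_add legop_family_scale)
  qed (simp add: legop_commute)
  have "tot d U N (tot d U N' \<psi>) = (\<Sum>i\<in>U. \<Sum>j\<in>U. legop d i N (legop d j N' \<psi>))"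
    by (simp add: tot_def legop_sum)
  also have "\<dots> = (\<Sum>i\<in>U. \<Sum>j\<in>U. legop d j N' (legop d i N \<psi>)) + (\<Sum>i\<in>U. cscale x (legop d i K \<psi>))"
    by (subst *) (simp add: sum.distrib sum.delta)
  also have "(\<Sum>i\<in>U. \<Sum>j\<in>U. legop d j N' (legop d i N \<psi>)) = tot d U N' (tot d U N \<psi>)"
    by (subst sum.swap) (simp add: tot_def legop_sum)
  finally show ?thesis by (simp only: tot_def cfun.scale_sum_right)
qed

lemma tot_commute:
  assumes "U \<inter> V = {}"
  shows "tot d U N (tot d V N' \<psi>) = tot d V N' (tot d U N \<psi>)"
proof -
  have "tot d U N (tot d V N' \<psi>) = (\<Sum>i\<in>U. \<Sum>j\<in>V. legop d i N (legop d j N' \<psi>))"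
    by (simp add: tot_def legop_sum)
  also have "\<dots> = (\<Sum>i\<in>U. \<Sum>j\<in>V. legop d j N' (legop d i N \<psi>))"
    using assms by (intro sum.cong refl legop_commute) auto
  also have "\<dots> = tot d V N' (tot d U N \<psi>)"
    by (subst sum.swap) (simp add: tot_def legop_sum)
  finally show ?thesis .
qed

lemma tot_union:
  assumes "U \<inter> V = {}"
  shows "tot d (U \<union> V) N \<psi> = tot d U N \<psi> + tot d V N \<psi>"
  unfolding tot_def by (rule sum.union_disjoint) (use assms in auto)

section \<open>Inner product and adjoints\<close>

lemma cinner_add_left: "cinner S (f + g) h = cinner S f h + cinner S g h"
  and cinner_add_right: "cinner S f (g + h) = cinner S f g + cinner S f h"
  and cinner_scale_left: "cinner S (cscale c f) h = cnj c * cinner S f h"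
  and cinner_scale_right: "cinner S f (cscale c h) = c * cinner S f h"
  by (simp_all add: cinner_def algebra_simps sum.distrib sum_distrib_left)

lemma cinner_0: "cinner S f 0 = 0" "cinner S 0 f = 0"
  by (simp_all add: cinner_def)

lemma cinner_sum_right: "cinner S f (sum h X) = (\<Sum>x\<in>X. cinner S f (h x))"
  by (induction X rule: infinite_finite_induct) (simp_all only: sum.infinite sum.empty sum.insert cinner_add_right not_False_eq_True cinner_0)

lemma cinner_sum_left: "cinner S (sum h X) f = (\<Sum>x\<in>X. cinner S (h x) f)"
  by (induction X rule: infinite_finite_induct) (simp_all only: sum.infinite sum.empty sum.insert cinner_add_left not_False_eq_True cinner_0)

lemma cinner_tot:
  assumes "\<And>n b c. b \<le> n \<Longrightarrow> c \<le> n \<Longrightarrow> N' n b c = cnj (N n c b)"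
  shows "cinner (configs d) \<phi> (tot d U N \<psi>) = cinner (configs d) (tot d U N' \<phi>) \<psi>"
  unfolding tot_def cinner_sum_left cinner_sum_right
  using assms by (intro sum.cong refl cinner_legop) auto

lemma cinner_self: "cinner S f f = of_real (\<Sum>x\<in>S. (cmod (f x))\<^sup>2)"
  by (simp add: cinner_def complex_norm_square mult.commute flip: of_real_power)

lemma cinner_self_eq_0:
  assumes "finite S" "\<And>x. x \<notin> S \<Longrightarrow> f x = 0" "cinner S f f = 0"
  shows "f = 0"
proof -
  have "(\<Sum>x\<in>S. (cmod (f x))\<^sup>2) = 0"
    using assms(3) unfolding cinner_self of_real_eq_0_iff .
  then have "f x = 0" if "x \<in> S" for x
    using that assms(1) by (simp add: sum_nonneg_eq_0_iff)
  with assms(2) show ?thesis by (auto simp: fun_eq_iff)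
qed

section \<open>The Lie algebra\<close>

text \<open>\<open>Zf\<close>, \<open>Pf\<close>, \<open>Mf\<close> are J_z, J_+, J_-. With j = n/2
  and m = c - n/2, the entry of \<open>Pf\<close> in column c is the usual sqrt((j - m)(j + m +
  1)).\<close>

definition Zf :: family where
  "Zf n b c = (if b = c then of_real (real b - real n / 2) else 0)"

definition Pf :: family where
  "Pf n b c = (if b = Suc c then of_real (sqrt (real b * (real n + 1 - real b))) else 0)"

definition Mf :: family where
  "Mf n b c = (if c = Suc b then of_real (sqrt (real c * (real n + 1 - real c))) else 0)"

lemma sqrt_of_real_square:
  "x \<ge> 0 \<Longrightarrow> complex_of_real (sqrt x) * complex_of_real (sqrt x) = of_real x"
  by (simp flip: of_real_mult)

lemma fmul_MP:
  assumes "b \<le> n" "c \<le> n"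
  shows "fmul Mf Pf n b c = (if b = c then (of_nat b + 1) * (of_nat n - of_nat b) else 0)"
proof -
  have "fmul Mf Pf n b c = (\<Sum>k\<le>n. if k = Suc b then Mf n b k * Pf n k c else 0)"
    unfolding fmul_def by (rule sum.cong) (auto simp: Mf_def)
  also have "\<dots> = (if Suc b \<le> n then Mf n b (Suc b) * Pf n (Suc b) c else 0)"
    by (simp add: sum.delta)
  also have "\<dots> = (if b = c then (of_nat b + 1) * (of_nat n - of_nat b) else 0)"
    using assms by (auto simp: Mf_def Pf_def sqrt_of_real_square not_le le_Suc_eq)
  finally show ?thesis .
qed

lemma fmul_PM:
  assumes "b \<le> n" "c \<le> n"
  shows "fmul Pf Mf n b c = (if b = c then of_nat b * (of_nat n + 1 - of_nat b) else 0)"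
proof (cases b)
  case 0
  then show ?thesis by (simp add: fmul_def Pf_def)
next
  case (Suc b')
  have "fmul Pf Mf n b c = (\<Sum>k\<le>n. if k = b' then Pf n b k * Mf n k c else 0)"
    unfolding fmul_def by (rule sum.cong) (auto simp: Pf_def Suc)
  also have "\<dots> = Pf n b b' * Mf n b' c"
    using assms Suc by (simp add: sum.delta)
  also have "\<dots> = (if b = c then of_nat b * (of_nat n + 1 - of_nat b) else 0)"
    using assms Suc by (auto simp: Mf_def Pf_def sqrt_of_real_square)
  finally show ?thesis .
qed

lemma fmul_Z:
  assumes "b \<le> n"
  shows "fmul Zf N n b c = of_real (real b - real n / 2) * N n b c"
proof -
  have "fmul Zf N n b c = (\<Sum>k\<le>n. if k = b then of_real (real b - real n / 2) * N n k c else 0)"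
    unfolding fmul_def by (rule sum.cong) (auto simp: Zf_def)
  then show ?thesis using assms by simp
qed

lemma fmul_Z_right:
  assumes "c \<le> n"
  shows "fmul N Zf n b c = N n b c * of_real (real c - real n / 2)"
proof -
  have "fmul N Zf n b c = (\<Sum>k\<le>n. if k = c then N n b k * of_real (real c - real n / 2) else 0)"
    unfolding fmul_def by (rule sum.cong) (auto simp: Zf_def)
  then show ?thesis using assms by simp
qed

lemma comm_ZP: "b \<le> n \<Longrightarrow> c \<le> n \<Longrightarrow> fmul Zf Pf n b c = fmul Pf Zf n b c + 1 * Pf n b c"
  by (simp add: fmul_Z fmul_Z_right) (simp add: Pf_def algebra_simps)

lemma comm_ZM: "b \<le> n \<Longrightarrow> c \<le> n \<Longrightarrow> fmul Zf Mf n b c = fmul Mf Zf n b c + (-1) * Mf n b c"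
  by (simp add: fmul_Z fmul_Z_right) (simp add: Mf_def algebra_simps)

lemma comm_PM: "b \<le> n \<Longrightarrow> c \<le> n \<Longrightarrow> fmul Pf Mf n b c = fmul Mf Pf n b c + 2 * Zf n b c"
  by (simp add: fmul_PM fmul_MP) (simp add: Zf_def algebra_simps)

text \<open>On an irreducible representation J_- J_+ + J_z^2 + J_z is J^2 = j(j + 1), which is n(n +
  2)/4 for j = n/2.\<close>

lemma casimir_family:
  assumes "b \<le> n" "c \<le> n"
  shows "fmul Mf Pf n b c + fmul Zf Zf n b c + Zf n b c =
    (if b = c then of_nat n * (of_nat n + 2) / 4 else 0)"
  using assms by (auto simp: fmul_MP fmul_Z) (auto simp: Zf_def field_simps)

lemma tot_ZP: "tot d U Zf (tot d U Pf \<psi>) = tot d U Pf (tot d U Zf \<psi>) + tot d U Pf \<psi>"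
  using tot_commutator[OF comm_ZP] by simp

lemma tot_ZM: "tot d U Zf (tot d U Mf \<psi>) = tot d U Mf (tot d U Zf \<psi>) - tot d U Mf \<psi>"
proof -
  have "cscale (-1) f = - f" for f :: "state" by (simp add: fun_eq_iff)
  then show ?thesis using tot_commutator[OF comm_ZM, of d U \<psi>] by simp
qed

lemma tot_PM: "tot d U Pf (tot d U Mf \<psi>) = tot d U Mf (tot d U Pf \<psi>) + cscale 2 (tot d U Zf \<psi>)"
  using tot_commutator[OF comm_PM] .

section \<open>The Casimir operator of a set of legs\<close>

definition cas :: "(leg \<Rightarrow> nat) \<Rightarrow> leg set \<Rightarrow> state \<Rightarrow> state" where
  "cas d U \<psi> = tot d U Mf (tot d U Pf \<psi>) + tot d U Zf (tot d U Zf \<psi>) + tot d U Zf \<psi>"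

lemma cinner_tot_P: "cinner (configs d) \<phi> (tot d U Pf \<psi>) = cinner (configs d) (tot d U Mf \<phi>) \<psi>"
  and cinner_tot_M: "cinner (configs d) \<phi> (tot d U Mf \<psi>) = cinner (configs d) (tot d U Pf \<phi>) \<psi>"
  and cinner_tot_Z: "cinner (configs d) \<phi> (tot d U Zf \<psi>) = cinner (configs d) (tot d U Zf \<phi>) \<psi>"
  by (rule cinner_tot; simp add: Pf_def Mf_def Zf_def)+

lemma cinner_cas: "cinner (configs d) \<phi> (cas d U \<psi>) = cinner (configs d) (cas d U \<phi>) \<psi>"
  by (simp add: cas_def cinner_add_left cinner_add_right cinner_tot_P cinner_tot_M cinner_tot_Z)

lemma cas_add: "cas d U (\<phi> + \<psi>) = cas d U \<phi> + cas d U \<psi>"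
  and cas_scale: "cas d U (cscale c \<psi>) = cscale c (cas d U \<psi>)"
  and cas_0: "cas d U 0 = 0"
  and cas_states: "\<psi> \<in> states d \<Longrightarrow> cas d U \<psi> \<in> states d"
  by (simp_all add: cas_def tot_add tot_scale tot_0 tot_states states_add cfun.scale_right_distrib)

lemma cas_comm_P: "tot d U Pf (cas d U \<psi>) = cas d U (tot d U Pf \<psi>)"
  by (simp add: cas_def tot_add tot_scale tot_PM tot_ZP fun_eq_iff)

lemma cas_comm_Z: "tot d U Zf (cas d U \<psi>) = cas d U (tot d U Zf \<psi>)"
  by (simp add: cas_def tot_add tot_diff tot_scale tot_ZM tot_ZP fun_eq_iff)

lemma cas_comm_M: "tot d U Mf (cas d U \<psi>) = cas d U (tot d U Mf \<psi>)"
  by (simp add: cas_def tot_add tot_diff tot_scale tot_ZM tot_PM fun_eq_iff)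

lemma cas_comm_disjoint: "U \<inter> V = {} \<Longrightarrow> tot d V N (cas d U \<psi>) = cas d U (tot d V N \<psi>)"
  using tot_commute[of V U d N] by (simp add: cas_def tot_add Int_commute)


section \<open>One-parameter subgroups\<close>

text \<open>The derivative of \<open>rot \<kappa> w t\<close> at t = 0, carried to spin n/2. The
  factor 2 before \<open>Zf\<close> arises because J_z is diag(1/2, -1/2) for spin 1/2, while that
  derivative has the diagonal i \<kappa>, -i \<kappa>.\<close>

definition Lf :: "real \<Rightarrow> complex \<Rightarrow> family" where
  "Lf \<kappa> w = (\<lambda>n b c. (2 * \<i> * of_real \<kappa> * Zf n b c + w * Mf n b c) + (- cnj w) * Pf n b c)"

text \<open>If \<open>\<kappa>\<^sup>2 + \<bar>w\<bar>\<^sup>2 = 1\<close>, the matrix \<open>K = rot \<kappa> w (pi/2)\<close> satisfies \<open>K\<^sup>2 = -1\<close>, so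
  \<open>rot \<kappa> w t = cos t + K sin t = exp (t K)\<close>.\<close>

definition rot :: "real \<Rightarrow> complex \<Rightarrow> real \<Rightarrow> complex ^ 2 ^ 2" where
  "rot \<kappa> w t = (\<chi> i j. if i = 1
     then (if j = 1 then of_real (cos t) + \<i> * of_real (\<kappa> * sin t) else - cnj w * of_real (sin t))
     else (if j = 1 then w * of_real (sin t) else of_real (cos t) - \<i> * of_real (\<kappa> * sin t)))"

lemma rot_entries:
  "rot \<kappa> w t $ 1 $ 1 = of_real (cos t) + \<i> * of_real (\<kappa> * sin t)"
  "rot \<kappa> w t $ 1 $ 2 = - cnj w * of_real (sin t)"
  "rot \<kappa> w t $ 2 $ 1 = w * of_real (sin t)"
  "rot \<kappa> w t $ 2 $ 2 = of_real (cos t) - \<i> * of_real (\<kappa> * sin t)"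
  by (simp_all add: rot_def)

lemma rot_norm:
  assumes "\<kappa>\<^sup>2 + (cmod w)\<^sup>2 = 1"
  shows "w * cnj w = 1 - (of_real \<kappa>)\<^sup>2"
proof -
  have "complex_of_real (\<kappa>\<^sup>2 + (cmod w)\<^sup>2) = 1" using assms by simp
  then show ?thesis by (simp add: complex_norm_square algebra_simps del: of_real_power) (simp add: algebra_simps)
qed

lemma rot_in_SU2:
  assumes "\<kappa>\<^sup>2 + (cmod w)\<^sup>2 = 1"
  shows "rot \<kappa> w t \<in> SU2"
proof -
  define C where "C = complex_of_real (cos t)"
  define S where "S = complex_of_real (sin t)"
  define k where "k = complex_of_real \<kappa>"
  have CS: "C * C = 1 - S * S"
    using sin_cos_squared_add[of t] unfolding C_def S_def
    by (metis add_diff_cancel_left' of_real_1 of_real_diff of_real_mult power2_eq_square)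
  have w: "w * cnj w = 1 - k * k" using rot_norm[OF assms] by (simp add: k_def power2_eq_square)
  \<comment> \<open>Expansion nests products to the right, so each quadratic relation is also
    supplied with a trailing factor.\<close>
  have w': "w * (cnj w * z) = (1 - k * k) * z" "cnj w * (w * z) = (1 - k * k) * z" for z
    by (simp_all flip: w)
  have CS': "C * (C * z) = (1 - S * S) * z" for z
    by (simp flip: CS)
  have i: "\<i> * (\<i> * z) = - z" for z by (simp flip: mult.assoc)
  have cnj: "cnj C = C" "cnj S = S" "cnj k = k" by (simp_all add: C_def S_def k_def)
  show ?thesis
    by (simp add: SU2_def vec_eq_iff forall_2 matrix_matrix_mult_def sum_2 transpose_def mat_def
        rot_entries det_2 flip: C_def S_def k_def)
       (auto simp: cnj algebra_simps w w' CS CS' i)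
qed

text \<open>Polar form of a unit quaternion: the real part of the (1,1) entry is cos t, and the
  three remaining real coordinates are sin t times a unit vector (\<kappa>, w).\<close>

lemma SU2_rot:
  assumes "g \<in> SU2"
  obtains \<kappa> w t where "\<kappa>\<^sup>2 + (cmod w)\<^sup>2 = 1" "g = rot \<kappa> w t"
proof -
  define a where "a = g $ 1 $ 1"
  define b where "b = g $ 1 $ 2"
  define c where "c = g $ 2 $ 1"
  define e where "e = g $ 2 $ 2"
  have 1: "a * cnj a + b * cnj b = 1" and 2: "cnj a * c + cnj b * e = 0" and 3: "a * e - b * c = 1"
    using assms by (auto simp: SU2_def vec_eq_iff forall_2 matrix_matrix_mult_def sum_2 transpose_def
        mat_def det_2 a_def b_def c_def e_def mult.commute)
  \<comment> \<open>Inserting relations 1 and 3 as factors equal to one turns the difference into a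
    multiple of relation 2.\<close>
  have "e = cnj a"
  proof -
    have "e - cnj a = e * (a * cnj a + b * cnj b) - cnj a * (a * e - b * c)"
      by (simp only: 1 3) simp
    also have "\<dots> = b * (cnj a * c + cnj b * e)" by (simp add: algebra_simps)
    finally show ?thesis by (simp only: 2) simp
  qed
  have "c = - cnj b"
  proof -
    have "c + cnj b = c * (a * cnj a + b * cnj b) + cnj b * (a * e - b * c)"
      by (simp only: 1 3) simp
    also have "\<dots> = a * (cnj a * c + cnj b * e)" by (simp add: algebra_simps)
    finally show ?thesis by (simp only: 2) (simp add: add_eq_0_iff2)
  qed
  have 4: "(Re a)\<^sup>2 + (Im a)\<^sup>2 + (cmod c)\<^sup>2 = 1"
  proof -
    have "complex_of_real ((cmod a)\<^sup>2 + (cmod b)\<^sup>2) = of_real 1"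
      using 1 by (simp only: of_real_add complex_norm_square of_real_1)
    then have "(cmod a)\<^sup>2 + (cmod b)\<^sup>2 = 1" unfolding of_real_eq_iff .
    then show ?thesis by (simp add: cmod_power2[of a] \<open>c = - cnj b\<close>)
  qed
  define t where "t = arccos (Re a)"
  have "(Re a)\<^sup>2 \<le> 1" using 4 by (smt (verit) zero_le_power2)
  then have r: "-1 \<le> Re a" "Re a \<le> 1" by (auto simp: abs_square_le_1)
  have ct: "cos t = Re a" and st: "sin t = sqrt (1 - (Re a)\<^sup>2)"
    using r by (simp_all add: t_def sin_arccos)
  have st2: "(sin t)\<^sup>2 = 1 - (Re a)\<^sup>2" using \<open>(Re a)\<^sup>2 \<le> 1\<close> by (simp add: st)
  have eqI: "g = rot \<kappa> w t" if "Im a = \<kappa> * sin t" "c = w * of_real (sin t)" for \<kappa> w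
  proof -
    have "b = - cnj c" using \<open>c = - cnj b\<close> by simp
    then have "b = - cnj w * of_real (sin t)" using that(2) by simp
    moreover have "a = of_real (cos t) + \<i> * of_real (\<kappa> * sin t)"
      by (simp add: complex_eq_iff ct that(1))
    moreover have "e = of_real (cos t) - \<i> * of_real (\<kappa> * sin t)"
      unfolding \<open>e = cnj a\<close> by (simp add: complex_eq_iff ct that(1))
    ultimately show ?thesis
      using that(2) by (simp add: vec_eq_iff forall_2 rot_entries a_def b_def c_def e_def)
  qed
  show thesis
  proof (cases "sin t = 0")
    case True
    then have "Im a = 0" "c = 0" using 4 st2 by (auto simp: sum_power2_eq_zero_iff)
    \<comment> \<open>Here g is 1 or -1 and the axis is arbitrary; (1, 0) is a choice.\<close>
    then show thesis using that[of 1 0] eqI[of 1 0] True by simp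
  next
    case False
    have "(Im a / sin t)\<^sup>2 + (cmod (c / of_real (sin t)))\<^sup>2 = ((Im a)\<^sup>2 + (cmod c)\<^sup>2) / (sin t)\<^sup>2"
      by (simp add: norm_divide power_divide add_divide_distrib)
    also have "(Im a)\<^sup>2 + (cmod c)\<^sup>2 = (sin t)\<^sup>2" using 4 st2 by simp
    also have "(sin t)\<^sup>2 / (sin t)\<^sup>2 = 1" using False by simp
    finally show thesis
      using that[of "Im a / sin t" "c / of_real (sin t)"] eqI[of "Im a / sin t" "c / of_real (sin t)"] False
      by simp
  qed
qed

text \<open>Differentiation is coefficientwise because \<open>D\<close> reads off a single
  coefficient of a product of powers.\<close>

definition pd :: "(real \<Rightarrow> complex poly) \<Rightarrow> complex poly \<Rightarrow> real \<Rightarrow> bool" where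
  "pd F F' t \<longleftrightarrow> (\<forall>b. ((\<lambda>s. coeff (F s) b) has_vector_derivative coeff F' b) (at t))"

lemma pd_mult:
  assumes "pd F F' t" "pd G G' t"
  shows "pd (\<lambda>s. F s * G s) (F t * G' + F' * G t) t"
  unfolding pd_def coeff_mult coeff_add
  using assms unfolding pd_def
  by (auto intro!: derivative_eq_intros has_vector_derivative_mult simp: sum.distrib)

lemma pd_power:
  assumes "pd F F' t"
  shows "pd (\<lambda>s. F s ^ n) (smult (of_nat n) (F t ^ (n - 1) * F')) t"
proof (induction n)
  case 0
  then show ?case by (simp add: pd_def)
next
  case (Suc n)
  \<comment> \<open>At n = 0 the exponent n - 1 truncates, but the factor \<open>of_nat n\<close> is
    zero.\<close>
  have "F t * smult (of_nat n) (F t ^ (n - 1) * F') + F' * F t ^ n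
      = smult (of_nat n) (F t ^ n * F') + smult 1 (F t ^ n * F')"
    by (cases n) (simp_all add: mult_ac)
  also have "\<dots> = smult (of_nat (Suc n)) (F t ^ (Suc n - 1) * F')"
    by (simp only: smult_add_left[symmetric]) (simp add: add.commute)
  finally have "F t * smult (of_nat n) (F t ^ (n - 1) * F') + F' * F t ^ n
      = smult (of_nat (Suc n)) (F t ^ (Suc n - 1) * F')" .
  with pd_mult[OF assms Suc.IH] show ?case by simp
qed

text \<open>Column \<open>a\<close> of \<open>Lf\<close> is supported on the rows a - 1, a and a +
  1. The conditionals mark the ends of the ladder, where a - 1 truncates and a + 1 leaves the
  range.\<close>

lemma sum_Lf:
  assumes "a \<le> n"
  shows "(\<Sum>c\<le>n. x c * Lf \<kappa> w n c a) =
     2 * \<i> * of_real \<kappa> * of_real (real a - real n / 2) * x a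
     + (if a = 0 then 0 else w * of_real (sqrt (real a * (real n + 1 - real a))) * x (a - 1))
     - (if a = n then 0 else cnj w * of_real (sqrt (real (Suc a) * (real n - real a))) * x (Suc a))"
proof -
  have "(\<Sum>c\<le>n. x c * Lf \<kappa> w n c a) = (\<Sum>c\<le>n.
      (if c = a then 2 * \<i> * of_real \<kappa> * of_real (real a - real n / 2) * x a else 0)
    + (if c = a - 1 then (if a = 0 then 0 else w * of_real (sqrt (real a * (real n + 1 - real a))) * x (a - 1)) else 0)
    - (if c = Suc a then cnj w * of_real (sqrt (real (Suc a) * (real n - real a))) * x (Suc a) else 0))"
    by (rule sum.cong) (auto simp: Lf_def Zf_def Mf_def Pf_def algebra_simps)
  also have "\<dots> = 2 * \<i> * of_real \<kappa> * of_real (real a - real n / 2) * x a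
     + (if a = 0 then 0 else w * of_real (sqrt (real a * (real n + 1 - real a))) * x (a - 1))
     - (if a = n then 0 else cnj w * of_real (sqrt (real (Suc a) * (real n - real a))) * x (Suc a))"
    using assms by (auto simp: sum.distrib sum_subtractf)
  finally show ?thesis .
qed

text \<open>Both follow from (a + 1) C(n, a + 1) = (n - a) C(n, a). They convert the exponents
  produced by the Leibniz rule into ladder coefficients of the normalized monomials.\<close>

lemma sqrt_binomial:
  assumes "a < n"
  shows "real (Suc a) * sqrt (real (n choose Suc a)) =
           sqrt (real (Suc a) * (real n - real a)) * sqrt (real (n choose a))"
    and "(real n - real a) * sqrt (real (n choose a)) =
           sqrt (real (Suc a) * (real n - real a)) * sqrt (real (n choose Suc a))"
proof -
  have "real (Suc a * (n choose Suc a)) = real ((n - a) * (n choose a))"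
    by (simp only: binomial_absorption binomial_absorb_comp)
  then have *: "real (Suc a) * real (n choose Suc a) = (real n - real a) * real (n choose a)"
    using assms by (simp only: of_nat_mult of_nat_diff less_imp_le)
  have s: "sqrt x * sqrt x = x" if "x \<ge> 0" for x :: real using that by simp
  have "real (Suc a) * sqrt (real (n choose Suc a)) =
      sqrt (real (Suc a)) * sqrt (real (Suc a) * real (n choose Suc a))"
    by (simp add: real_sqrt_mult flip: mult.assoc)
  then show "real (Suc a) * sqrt (real (n choose Suc a)) =
           sqrt (real (Suc a) * (real n - real a)) * sqrt (real (n choose a))"
    by (simp only: *) (simp add: real_sqrt_mult)
  have "(real n - real a) * sqrt (real (n choose a)) =
      sqrt (real n - real a) * sqrt ((real n - real a) * real (n choose a))"
    using assms s[of "real n - real a"] by (simp add: real_sqrt_mult mult.assoc[symmetric] del: real_sqrt_mult_self)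
  then show "(real n - real a) * sqrt (real (n choose a)) =
           sqrt (real (Suc a) * (real n - real a)) * sqrt (real (n choose Suc a))"
    by (simp only: flip: *) (simp add: real_sqrt_mult)
qed

text \<open>K^2 = -1 gives rot' = rot K, so the derivative at any t is the value at t times a
  constant matrix. In polynomials, the images p, q of x, y obey the linear system \<open>p'\<close>,
  \<open>q'\<close>, and the Leibniz rule for p^a q^(n - a) yields the three terms of
  \<open>sum_Lf\<close>.\<close>

lemma D_rot_derivative:
  assumes kw: "\<kappa>\<^sup>2 + (cmod w)\<^sup>2 = 1" and a: "a \<le> n"
  shows "((\<lambda>s. D n (rot \<kappa> w s) b a) has_vector_derivative
           (\<Sum>c\<le>n. D n (rot \<kappa> w t) b c * Lf \<kappa> w n c a)) (at t)"
proof -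
  define p where "p s = [:rot \<kappa> w s $ 2 $ 1, rot \<kappa> w s $ 1 $ 1:]" for s
  define q where "q s = [:rot \<kappa> w s $ 2 $ 2, rot \<kappa> w s $ 1 $ 2:]" for s
  define k where "k = \<i> * complex_of_real \<kappa>"
  define r where "r c = complex_of_real (sqrt (real (n choose c)))" for c
  have D: "D n (rot \<kappa> w s) b c = r c / r b * coeff (p s ^ c * q s ^ (n - c)) b" for s c
    by (simp add: D_def p_def q_def r_def real_sqrt_divide)
  have w: "w * cnj w = 1 - of_real \<kappa> * of_real \<kappa>"
    using rot_norm[OF kw] by (simp add: power2_eq_square)
  have w': "w * (cnj w * z) = (1 - of_real \<kappa> * of_real \<kappa>) * z"
    "cnj w * (w * z) = (1 - of_real \<kappa> * of_real \<kappa>) * z" for z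
    by (simp_all flip: w)
  have i: "\<i> * (\<i> * z) = - z" for z by (simp flip: mult.assoc)
  have p': "pd p (smult k (p t) + smult w (q t)) t"
    unfolding pd_def
  proof
    fix b :: nat
    consider "b = 0" | "b = 1" | "b \<ge> 2" by linarith
    then show "((\<lambda>s. coeff (p s) b) has_vector_derivative coeff (smult k (p t) + smult w (q t)) b) (at t)"
      by cases
        (auto simp: p_def q_def rot_entries k_def coeff_pCons algebra_simps w w' i numeral_2_eq_2 split: nat.splits
          intro!: derivative_eq_intros)
  qed
  have q': "pd q (smult (- cnj w) (p t) + smult (- k) (q t)) t"
    unfolding pd_def
  proof
    fix b :: nat
    consider "b = 0" | "b = 1" | "b \<ge> 2" by linarith
    then show "((\<lambda>s. coeff (q s) b) has_vector_derivative
        coeff (smult (- cnj w) (p t) + smult (- k) (q t)) b) (at t)"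
      by cases
        (auto simp: p_def q_def rot_entries k_def coeff_pCons algebra_simps w w' i numeral_2_eq_2 split: nat.splits
          intro!: derivative_eq_intros)
  qed
  define F where "F = (smult (of_nat a) (p t ^ (a - 1) * (smult k (p t) + smult w (q t)))) * q t ^ (n - a)
     + p t ^ a * (smult (of_nat (n - a)) (q t ^ (n - a - 1) * (smult (- cnj w) (p t) + smult (- k) (q t))))"
  have "pd (\<lambda>s. p s ^ a * q s ^ (n - a)) F t"
    using pd_mult[OF pd_power[OF p', of a] pd_power[OF q', of "n - a"]] by (simp add: F_def add.commute)
  then have 1: "((\<lambda>s. D n (rot \<kappa> w s) b a) has_vector_derivative r a / r b * coeff F b) (at t)"
    unfolding D pd_def by (auto intro!: derivative_eq_intros)
  define x where "x c = coeff (p t ^ c * q t ^ (n - c)) b" for c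
  \<comment> \<open>Trading a factor p for q, or q for p in \<open>F2\<close>, gives the
    neighbouring monomials of the same degree n.\<close>
  have F1: "smult (of_nat a) (p t ^ (a - 1) * (smult k (p t) + smult w (q t))) * q t ^ (n - a)
     = smult (k * of_nat a) (p t ^ a * q t ^ (n - a))
       + (if a = 0 then 0 else smult (w * of_nat a) (p t ^ (a - 1) * q t ^ (n - (a - 1))))"
  proof (cases a)
    case (Suc a')
    then have "n - a' = Suc (n - a)" using a by simp
    then show ?thesis by (simp add: Suc algebra_simps smult_add_right)
  qed simp
  have F2: "p t ^ a * (smult (of_nat (n - a)) (q t ^ (n - a - 1) * (smult (- cnj w) (p t) + smult (- k) (q t))))
     = smult (- k * of_nat (n - a)) (p t ^ a * q t ^ (n - a))
       - (if a = n then 0 else smult (cnj w * of_nat (n - a)) (p t ^ Suc a * q t ^ (n - Suc a)))"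
  proof (cases "a = n")
    case False
    then obtain m where "n - a = Suc m" "n - Suc a = m"
      using a by (metis Suc_diff_Suc le_neq_implies_less)
    then show ?thesis using False
      by (intro poly_eqI) (simp add: algebra_simps)
  qed simp
  have 2: "coeff F b = k * (of_nat a - of_nat (n - a)) * x a
      + (if a = 0 then 0 else w * of_nat a * x (a - 1))
      - (if a = n then 0 else cnj w * of_nat (n - a) * x (Suc a))"
    unfolding F_def F1 F2 x_def by (auto simp: algebra_simps)
  have "r a / r b * coeff F b = (\<Sum>c\<le>n. D n (rot \<kappa> w t) b c * Lf \<kappa> w n c a)"
  proof -
    have down: "of_nat a * r a = of_real (sqrt (real a * (real n + 1 - real a))) * r (a - 1)" if "a \<noteq> 0"
      using arg_cong[OF sqrt_binomial(1)[of "a - 1" n], of complex_of_real] that a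
      by (simp add: r_def algebra_simps)
    have up: "of_nat (n - a) * r a = of_real (sqrt (real (Suc a) * (real n - real a))) * r (Suc a)" if "a \<noteq> n"
      using arg_cong[OF sqrt_binomial(2)[of a n], of complex_of_real] that a
      by (simp add: r_def of_nat_diff)
    have k: "k * (of_nat a - of_nat (n - a)) = 2 * \<i> * of_real \<kappa> * of_real (real a - real n / 2)"
      using a by (simp add: k_def of_nat_diff)
    have "r a * coeff F b = k * (of_nat a - of_nat (n - a)) * (r a * x a)
      + (if a = 0 then 0 else w * (of_nat a * r a) * x (a - 1))
      - (if a = n then 0 else cnj w * (of_nat (n - a) * r a) * x (Suc a))"
      unfolding 2 by (simp add: algebra_simps)
    also have "\<dots> = 2 * \<i> * of_real \<kappa> * of_real (real a - real n / 2) * (r a * x a)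
      + (if a = 0 then 0 else w * of_real (sqrt (real a * (real n + 1 - real a))) * (r (a - 1) * x (a - 1)))
      - (if a = n then 0 else cnj w * of_real (sqrt (real (Suc a) * (real n - real a))) * (r (Suc a) * x (Suc a)))"
    proof -
      have "(if a = 0 then 0 else w * (of_nat a * r a) * x (a - 1)) =
          (if a = 0 then 0 else w * of_real (sqrt (real a * (real n + 1 - real a))) * (r (a - 1) * x (a - 1)))"
        by (rule if_cong) (simp_all only: down mult.assoc not_False_eq_True)
      moreover have "(if a = n then 0 else cnj w * (of_nat (n - a) * r a) * x (Suc a)) =
          (if a = n then 0 else cnj w * of_real (sqrt (real (Suc a) * (real n - real a))) * (r (Suc a) * x (Suc a)))"
        by (rule if_cong) (simp_all only: up mult.assoc not_False_eq_True)
      ultimately show ?thesis by (simp only: k)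
    qed
    also have "\<dots> = (\<Sum>c\<le>n. r c * x c * Lf \<kappa> w n c a)"
      by (simp only: sum_Lf[OF a])
    finally have "r a * coeff F b / r b = (\<Sum>c\<le>n. r c * x c * Lf \<kappa> w n c a) / r b" by (rule arg_cong)
    then show ?thesis
      by (simp add: D x_def sum_divide_distrib)
  qed
  with 1 show ?thesis by simp
qed


section \<open>Derivative of the group action on states\<close>

lemma D_rot_0: "b \<le> n \<Longrightarrow> D n (rot \<kappa> w 0) b a = (if b = a then 1 else 0)"
proof -
  assume b: "b \<le> n"
  have "monom (1::complex) a = [:0, 1:] ^ a" by (subst monom_altdef) simp
  then have 1: "coeff ([:0, 1:] ^ a :: complex poly) b = (if b = a then 1 else 0)"
    by (metis coeff_monom)
  have p: "[:rot \<kappa> w 0 $ 2 $ 1, rot \<kappa> w 0 $ 1 $ 1:] = [:0, 1:]" "[:rot \<kappa> w 0 $ 2 $ 2, rot \<kappa> w 0 $ 1 $ 2:] = 1"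
    by (simp_all add: rot_entries)
  show ?thesis
    unfolding D_def p power_one mult_1_right 1 using b by simp
qed

lemma act_rot_0:
  assumes "\<psi> \<in> states d"
  shows "act d U (rot \<kappa> w 0) \<psi> = \<psi>"
proof
  fix m
  show "act d U (rot \<kappa> w 0) \<psi> m = \<psi> m"
  proof (cases "m \<in> configs d")
    case True
    let ?S = "{m' \<in> configs d. \<forall>i. i \<notin> U \<longrightarrow> m' i = m i}"
    have "(\<Sum>m' \<in> ?S. (\<Prod>i\<in>U. D (d i) (rot \<kappa> w 0) (m i) (m' i)) * \<psi> m') =
      (\<Sum>m' \<in> ?S. if m' = m then \<psi> m' else 0)"
    proof (intro sum.cong refl)
      fix m' assume m': "m' \<in> ?S"
      have "(\<Prod>i\<in>U. D (d i) (rot \<kappa> w 0) (m i) (m' i)) = (\<Prod>i\<in>U. if m i = m' i then 1 else 0)"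
        using True by (intro prod.cong refl D_rot_0) (simp add: configs_def)
      also have "\<dots> = (if m' = m then 1 else 0)"
      proof (cases "m' = m")
        case False
        then obtain i where "m' i \<noteq> m i" by blast
        then have "i \<in> U" using m' by auto
        then show ?thesis using False \<open>m' i \<noteq> m i\<close> by (auto intro!: prod_zero bexI[of _ i])
      qed simp
      finally show "(\<Prod>i\<in>U. D (d i) (rot \<kappa> w 0) (m i) (m' i)) * \<psi> m' = (if m' = m then \<psi> m' else 0)"
        by simp
    qed
    also have "\<dots> = \<psi> m" using True by simp
    finally show ?thesis using True by (simp add: act_def)
  next
    case False
    then show ?thesis using assms by (simp add: act_def states_def)
  qed
qed

lemma act_add: "act d U g (\<phi> + \<psi>) = act d U g \<phi> + act d U g \<psi>"
  by (auto simp: act_def fun_eq_iff algebra_simps sum.distrib)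

lemma act_scale: "act d U g (cscale c \<psi>) = cscale c (act d U g \<psi>)"
  by (auto simp: act_def fun_eq_iff sum_distrib_left mult_ac)

lemma act_0: "act d U g 0 = 0"
  by (auto simp: act_def fun_eq_iff)

lemma act_sum: "act d U g (sum f S) = (\<Sum>x\<in>S. act d U g (f x))"
  by (induction S rule: infinite_finite_induct)
    (simp_all only: sum.infinite sum.empty sum.insert act_0 act_add not_False_eq_True)

lemma has_vector_derivative_prod:
  fixes f :: "'i \<Rightarrow> real \<Rightarrow> complex"
  assumes "\<And>i. i \<in> I \<Longrightarrow> (f i has_vector_derivative f' i) (at t)"
  shows "((\<lambda>s. \<Prod>i\<in>I. f i s) has_vector_derivative (\<Sum>i\<in>I. f' i * (\<Prod>j\<in>I - {i}. f j t))) (at t)"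
  using has_derivative_prod[of I f "\<lambda>i y. y *\<^sub>R f' i" t UNIV] assms
  by (simp add: has_vector_derivative_def scaleR_sum_right)

text \<open>The Leibniz rule over the legs puts \<open>Lf\<close> next to one factor
  \<open>D\<close>; reindexing with \<open>sum_configs_upd_swap\<close> lets it act on the state
  before the group element does.\<close>

lemma act_rot_derivative:
  assumes kw: "\<kappa>\<^sup>2 + (cmod w)\<^sup>2 = 1"
  shows "((\<lambda>s. act d U (rot \<kappa> w s) \<psi> m) has_vector_derivative
           act d U (rot \<kappa> w t) (tot d U (Lf \<kappa> w) \<psi>) m) (at t)"
proof (cases "m \<in> configs d")
  case False
  then show ?thesis by (simp add: act_def)
next
  case True
  let ?S = "{m' \<in> configs d. \<forall>i. i \<notin> U \<longrightarrow> m' i = m i}"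
  let ?D = "\<lambda>i a. D (d i) (rot \<kappa> w t) (m i) a"
  have S: "finite ?S" by (rule finite_subset[OF _ finite_configs[of d]]) auto
  have "((\<lambda>s. \<Sum>m' \<in> ?S. (\<Prod>i\<in>U. D (d i) (rot \<kappa> w s) (m i) (m' i)) * \<psi> m') has_vector_derivative
    (\<Sum>m' \<in> ?S. (\<Sum>j\<in>U. (\<Sum>c\<le>d j. ?D j c * Lf \<kappa> w (d j) c (m' j)) * (\<Prod>i\<in>U - {j}. ?D i (m' i))) * \<psi> m')) (at t)"
    by (intro has_vector_derivative_sum has_vector_derivative_mult_left has_vector_derivative_prod
        D_rot_derivative[OF kw]) (auto simp: configs_def)
  also have "(\<Sum>m' \<in> ?S. (\<Sum>j\<in>U. (\<Sum>c\<le>d j. ?D j c * Lf \<kappa> w (d j) c (m' j)) * (\<Prod>i\<in>U - {j}. ?D i (m' i))) * \<psi> m') =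
     (\<Sum>j\<in>U. \<Sum>m' \<in> ?S. \<Sum>c\<le>d j. ?D j c * Lf \<kappa> w (d j) c (m' j) * (\<Prod>i\<in>U - {j}. ?D i (m' i)) * \<psi> m')"
    by (subst sum.swap) (simp add: sum_distrib_right)
  \<comment> \<open>The lone factor with index c is absorbed into the full product, taken at the
    configuration m'(j := c).\<close>
  also have "\<dots> = (\<Sum>j\<in>U. \<Sum>m' \<in> ?S. \<Sum>c\<le>d j.
        (\<Prod>i\<in>U. ?D i ((m'(j := c)) i)) * (Lf \<kappa> w (d j) ((m'(j := c)) j) (m' j) * \<psi> m'))"
  proof (intro sum.cong refl)
    fix j m' c assume "j \<in> U"
    have "(\<Prod>i\<in>U. ?D i ((m'(j := c)) i)) = ?D j c * (\<Prod>i\<in>U - {j}. ?D i ((m'(j := c)) i))"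
      using \<open>j \<in> U\<close> by (subst prod.remove[of U j]) auto
    also have "(\<Prod>i\<in>U - {j}. ?D i ((m'(j := c)) i)) = (\<Prod>i\<in>U - {j}. ?D i (m' i))"
      by (intro prod.cong) auto
    finally show "?D j c * Lf \<kappa> w (d j) c (m' j) * (\<Prod>i\<in>U - {j}. ?D i (m' i)) * \<psi> m' =
        (\<Prod>i\<in>U. ?D i ((m'(j := c)) i)) * (Lf \<kappa> w (d j) ((m'(j := c)) j) (m' j) * \<psi> m')"
      by (simp add: mult_ac)
  qed
  also have "\<dots> = (\<Sum>j\<in>U. \<Sum>m' \<in> ?S. \<Sum>c\<le>d j.
        (\<Prod>i\<in>U. ?D i (m' i)) * (Lf \<kappa> w (d j) (m' j) ((m'(j := c)) j) * \<psi> (m'(j := c))))"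
  proof (rule sum.cong[OF refl])
    fix j assume "j \<in> U"
    then show "(\<Sum>m' \<in> ?S. \<Sum>c\<le>d j.
        (\<Prod>i\<in>U. ?D i ((m'(j := c)) i)) * (Lf \<kappa> w (d j) ((m'(j := c)) j) (m' j) * \<psi> m')) =
      (\<Sum>m' \<in> ?S. \<Sum>c\<le>d j.
        (\<Prod>i\<in>U. ?D i (m' i)) * (Lf \<kappa> w (d j) (m' j) ((m'(j := c)) j) * \<psi> (m'(j := c))))"
      by (intro sum_configs_upd_swap[OF S, symmetric]) (auto simp: configs_def)
  qed
  also have "\<dots> = (\<Sum>j\<in>U. \<Sum>m' \<in> ?S. (\<Prod>i\<in>U. ?D i (m' i)) * legop d j (Lf \<kappa> w) \<psi> m')"
    by (intro sum.cong refl) (auto simp: legop_def sum_distrib_left configs_def)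
  also have "\<dots> = (\<Sum>m' \<in> ?S. (\<Prod>i\<in>U. ?D i (m' i)) * tot d U (Lf \<kappa> w) \<psi> m')"
    by (subst sum.swap) (simp add: tot_def sum_fun_apply sum_distrib_left)
  finally show ?thesis using True by (simp add: act_def)
qed

section \<open>Infinitesimal equivariance\<close>

text \<open>Equivariance under one generator at a time. The condition is complex linear in the
  generator, so it extends from su(2) to \<open>Pf\<close> and \<open>Mf\<close>, which lie only in
  the complexification.\<close>

definition lie :: "(leg \<Rightarrow> nat) \<Rightarrow> leg set \<Rightarrow> nat \<Rightarrow> (nat \<Rightarrow> state) \<Rightarrow> family \<Rightarrow> bool" where
  "lie d U k T N \<longleftrightarrow> (\<forall>a\<le>k. tot d U N (T a) = (\<Sum>b\<le>k. cscale (N k b a) (T b)))"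

lemma lie_add: "lie d U k T N \<Longrightarrow> lie d U k T N' \<Longrightarrow> lie d U k T (\<lambda>n b c. N n b c + N' n b c)"
  by (simp add: lie_def tot_family_add cfun.scale_left_distrib sum.distrib)

lemma lie_scale: "lie d U k T N \<Longrightarrow> lie d U k T (\<lambda>n b c. x * N n b c)"
  by (simp add: lie_def tot_family_scale cfun.scale_sum_right)

lemma equivariant_imp_lie_Lf:
  assumes "equivariant d U k T" and kw: "\<kappa>\<^sup>2 + (cmod w)\<^sup>2 = 1"
  shows "lie d U k T (Lf \<kappa> w)"
  unfolding lie_def
proof (intro allI impI ext)
  fix a m assume a: "a \<le> k"
  have st: "T b \<in> states d" if "b \<le> k" for b using that assms by (simp add: equivariant_def)
  have "((\<lambda>s. act d U (rot \<kappa> w s) (T a) m) has_vector_derivative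
           act d U (rot \<kappa> w 0) (tot d U (Lf \<kappa> w) (T a)) m) (at 0)"
    by (rule act_rot_derivative[OF kw])
  moreover have "(\<lambda>s. act d U (rot \<kappa> w s) (T a) m) = (\<lambda>s. \<Sum>b\<le>k. D k (rot \<kappa> w s) b a * T b m)"
    using assms a rot_in_SU2[OF kw] by (simp add: equivariant_def sum_fun_apply)
  moreover have "((\<lambda>s. \<Sum>b\<le>k. D k (rot \<kappa> w s) b a * T b m) has_vector_derivative
      (\<Sum>b\<le>k. (\<Sum>c\<le>k. D k (rot \<kappa> w 0) b c * Lf \<kappa> w k c a) * T b m)) (at 0)"
    by (intro has_vector_derivative_sum has_vector_derivative_mult_left D_rot_derivative[OF kw a])
  ultimately have "act d U (rot \<kappa> w 0) (tot d U (Lf \<kappa> w) (T a)) m =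
      (\<Sum>b\<le>k. (\<Sum>c\<le>k. D k (rot \<kappa> w 0) b c * Lf \<kappa> w k c a) * T b m)"
    by (auto intro: vector_derivative_unique_at)
  also have "\<dots> = (\<Sum>b\<le>k. Lf \<kappa> w k b a * T b m)"
  proof (intro sum.cong refl)
    fix b assume b: "b \<in> {..k}"
    have "(\<Sum>c\<le>k. D k (rot \<kappa> w 0) b c * Lf \<kappa> w k c a) = (\<Sum>c\<le>k. if c = b then Lf \<kappa> w k c a else 0)"
      using b by (intro sum.cong) (auto simp: D_rot_0)
    then show "(\<Sum>c\<le>k. D k (rot \<kappa> w 0) b c * Lf \<kappa> w k c a) * T b m = Lf \<kappa> w k b a * T b m"
      using b by simp
  qed
  finally show "tot d U (Lf \<kappa> w) (T a) m = (\<Sum>b\<le>k. cscale (Lf \<kappa> w k b a) (T b)) m"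
    by (simp add: act_rot_0 tot_states st a sum_fun_apply)
qed

lemma equivariant_imp_lie:
  assumes "equivariant d U k T"
  shows "lie d U k T Zf" "lie d U k T Pf" "lie d U k T Mf"
proof -
  \<comment> \<open>Three rotation axes: they give 2 i J_z, J_- - J_+ and i (J_- + J_+), which span
    all generators over the complex numbers.\<close>
  have 1: "lie d U k T (Lf 1 0)" "lie d U k T (Lf 0 1)" "lie d U k T (Lf 0 \<i>)"
    using equivariant_imp_lie_Lf[OF assms] by auto
  have Z: "(\<lambda>n b c. (1 / (2 * \<i>)) * Lf 1 0 n b c) = Zf"
    by (simp add: Lf_def fun_eq_iff)
  have P: "(\<lambda>n b c. (-1/2) * Lf 0 1 n b c + (- \<i>/2) * Lf 0 \<i> n b c) = Pf"
    by (simp add: Lf_def fun_eq_iff field_simps)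
  have M: "(\<lambda>n b c. (1/2) * Lf 0 1 n b c + (- \<i>/2) * Lf 0 \<i> n b c) = Mf"
    by (simp add: Lf_def fun_eq_iff field_simps)
  show "lie d U k T Zf" using lie_scale[OF 1(1), of "1 / (2 * \<i>)"] unfolding Z .
  show "lie d U k T Pf"
    using lie_add[OF lie_scale[OF 1(2), of "-1/2"] lie_scale[OF 1(3), of "-\<i>/2"]] unfolding P .
  show "lie d U k T Mf"
    using lie_add[OF lie_scale[OF 1(2), of "1/2"] lie_scale[OF 1(3), of "-\<i>/2"]] unfolding M .
qed

lemma Lf_antihermitian: "Lf \<kappa> w n b c = - cnj (Lf \<kappa> w n c b)"
  by (auto simp: Lf_def Zf_def Pf_def Mf_def)

lemma lie_imp_equivariant:
  assumes st: "\<And>a. a \<le> k \<Longrightarrow> T a \<in> states d"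
    and lie: "lie d U k T Zf" "lie d U k T Pf" "lie d U k T Mf"
  shows "equivariant d U k T"
  unfolding equivariant_def
proof (intro conjI ballI allI impI st ext)
  fix g a m assume "g \<in> SU2" and a: "a \<le> k"
  then obtain \<kappa> w t0 where kw: "\<kappa>\<^sup>2 + (cmod w)\<^sup>2 = 1" and g: "g = rot \<kappa> w t0"
    using SU2_rot by blast
  have L: "lie d U k T (Lf \<kappa> w)"
    unfolding Lf_def using lie by (intro lie_add lie_scale)
  \<comment> \<open>The defect of equivariance at one fixed configuration m, as a vector indexed by
    c: it solves a linear system whose constant coefficients are entries of
    \<open>Lf\<close>.\<close>
  define y where "y = (\<lambda>c t. act d U (rot \<kappa> w t) (T c) m - (\<Sum>b\<le>k. D k (rot \<kappa> w t) b c * T b m))"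
  have y': "(y c has_vector_derivative (\<Sum>e\<le>k. Lf \<kappa> w k e c * y e t)) (at t)" if c: "c \<le> k" for c t
  proof -
    have "(y c has_vector_derivative
        (act d U (rot \<kappa> w t) (tot d U (Lf \<kappa> w) (T c)) m
         - (\<Sum>b\<le>k. (\<Sum>e\<le>k. D k (rot \<kappa> w t) b e * Lf \<kappa> w k e c) * T b m))) (at t)"
      unfolding y_def
      by (intro has_vector_derivative_diff has_vector_derivative_sum has_vector_derivative_mult_left
          D_rot_derivative[OF kw c] act_rot_derivative[OF kw])
    also have "act d U (rot \<kappa> w t) (tot d U (Lf \<kappa> w) (T c)) m
        = (\<Sum>e\<le>k. Lf \<kappa> w k e c * act d U (rot \<kappa> w t) (T e) m)"
      using L c by (simp add: lie_def act_sum act_scale sum_fun_apply)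
    also have "(\<Sum>b\<le>k. (\<Sum>e\<le>k. D k (rot \<kappa> w t) b e * Lf \<kappa> w k e c) * T b m) =
        (\<Sum>e\<le>k. Lf \<kappa> w k e c * (\<Sum>b\<le>k. D k (rot \<kappa> w t) b e * T b m))"
      unfolding sum_distrib_left sum_distrib_right by (subst sum.swap) (simp add: mult_ac)
    finally show ?thesis by (simp add: y_def right_diff_distrib sum_subtractf)
  qed
  define E where "E t = (\<Sum>c\<le>k. y c t * cnj (y c t))" for t
  have "(E has_vector_derivative 0) (at t)" for t
  proof -
    have "(E has_vector_derivative (\<Sum>c\<le>k. y c t * cnj (\<Sum>e\<le>k. Lf \<kappa> w k e c * y e t)
         + (\<Sum>e\<le>k. Lf \<kappa> w k e c * y e t) * cnj (y c t))) (at t)"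
      unfolding E_def using y'
      by (intro has_vector_derivative_sum has_vector_derivative_mult has_vector_derivative_cnj) auto
    also have "(\<Sum>c\<le>k. y c t * cnj (\<Sum>e\<le>k. Lf \<kappa> w k e c * y e t)
         + (\<Sum>e\<le>k. Lf \<kappa> w k e c * y e t) * cnj (y c t)) =
       (\<Sum>c\<le>k. \<Sum>e\<le>k. y c t * cnj (Lf \<kappa> w k e c) * cnj (y e t)) +
       (\<Sum>c\<le>k. \<Sum>e\<le>k. Lf \<kappa> w k e c * y e t * cnj (y c t))"
      by (simp add: sum.distrib sum_distrib_left sum_distrib_right mult_ac)
    also have "(\<Sum>c\<le>k. \<Sum>e\<le>k. Lf \<kappa> w k e c * y e t * cnj (y c t)) =
       (\<Sum>c\<le>k. \<Sum>e\<le>k. - (y c t * cnj (Lf \<kappa> w k e c) * cnj (y e t)))"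
      by (subst sum.swap, subst Lf_antihermitian) (simp add: mult_ac)
    finally show ?thesis by (simp add: sum_negf)
  qed
  then obtain C where "E t = C" for t
    using has_vector_derivative_zero_constant[of UNIV E] by auto
  moreover have "y c 0 = 0" if "c \<le> k" for c
  proof -
    have "(\<Sum>b\<le>k. D k (rot \<kappa> w 0) b c * T b m) = (\<Sum>b\<le>k. if b = c then T b m else 0)"
      by (intro sum.cong) (auto simp: D_rot_0)
    then show ?thesis using that by (simp add: y_def act_rot_0 st)
  qed
  then have "E 0 = 0" by (simp add: E_def)
  ultimately have "E t0 = 0" by metis
  then have "complex_of_real (\<Sum>c\<le>k. (cmod (y c t0))\<^sup>2) = 0"
    by (simp only: E_def complex_norm_square of_real_sum)
  then have "(\<Sum>c\<le>k. (cmod (y c t0))\<^sup>2) = 0" unfolding of_real_eq_0_iff .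
  then have "y a t0 = 0" using a by (simp add: sum_nonneg_eq_0_iff)
  then show "act d U g (T a) m = (\<Sum>b\<le>k. cscale (D k g b a) (T b)) m"
    by (simp add: y_def g sum_fun_apply)
qed

lemma equivariant_iff:
  "equivariant d U k T \<longleftrightarrow>
     (\<forall>a\<le>k. T a \<in> states d) \<and> lie d U k T Zf \<and> lie d U k T Pf \<and> lie d U k T Mf"
  using equivariant_imp_lie[of d U k T] lie_imp_equivariant[of k T d U]
  by (auto simp: equivariant_def)

text \<open>An invariant vector is an equivariant map from spin 0, where every generator is
  zero.\<close>

lemma intertwiners_iff:
  "\<psi> \<in> intertwiners d \<longleftrightarrow>
     \<psi> \<in> states d \<and> tot d UNIV Zf \<psi> = 0 \<and> tot d UNIV Pf \<psi> = 0 \<and> tot d UNIV Mf \<psi> = 0"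
proof -
  have "\<psi> \<in> intertwiners d \<longleftrightarrow> equivariant d UNIV 0 (\<lambda>_. \<psi>)"
    by (auto simp: intertwiners_def equivariant_def D_def)
  also have "\<dots> \<longleftrightarrow> \<psi> \<in> states d \<and> tot d UNIV Zf \<psi> = 0 \<and> tot d UNIV Pf \<psi> = 0 \<and> tot d UNIV Mf \<psi> = 0"
    by (auto simp: equivariant_iff lie_def Zf_def Pf_def Mf_def)
  finally show ?thesis .
qed


section \<open>Coupled states as Casimir eigenvectors\<close>

lemma lie_comp:
  assumes "lie d U k T N" "lie d U k T N'" "a \<le> k"
  shows "tot d U N (tot d U N' (T a)) = (\<Sum>b\<le>k. cscale (fmul N N' k b a) (T b))"
proof -
  have "tot d U N (tot d U N' (T a)) = (\<Sum>c\<le>k. cscale (N' k c a) (\<Sum>b\<le>k. cscale (N k b c) (T b)))"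
    using assms by (simp add: lie_def tot_sum tot_scale)
  also have "\<dots> = (\<Sum>b\<le>k. \<Sum>c\<le>k. cscale (N k b c * N' k c a) (T b))"
    by (subst sum.swap) (simp add: cfun.scale_sum_right mult.commute)
  finally show ?thesis by (simp add: fmul_def cfun.scale_sum_left)
qed

lemma cas_equivariant:
  assumes "equivariant d U k T" "a \<le> k"
  shows "cas d U (T a) = cscale (of_nat k * (of_nat k + 2) / 4) (T a)"
proof -
  have l: "lie d U k T Zf" "lie d U k T Pf" "lie d U k T Mf"
    using equivariant_imp_lie[OF assms(1)] by auto
  have "cas d U (T a) = (\<Sum>b\<le>k. cscale (fmul Mf Pf k b a + fmul Zf Zf k b a + Zf k b a) (T b))"
    using l(1) assms(2) unfolding cas_def lie_comp[OF l(3,2) assms(2)] lie_comp[OF l(1,1) assms(2)]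
    by (simp add: lie_def cfun.scale_left_distrib sum.distrib)
  also have "\<dots> = (\<Sum>b\<le>k. if b = a then cscale (of_nat k * (of_nat k + 2) / 4) (T a) else 0)"
    using assms(2) by (intro sum.cong) (auto simp: casimir_family)
  finally show ?thesis using assms(2) by simp
qed

lemma coupled_cas:
  assumes "\<psi> \<in> coupled d U k"
  shows "\<psi> \<in> states d \<and> cas d U \<psi> = cscale (of_nat k * (of_nat k + 2) / 4) \<psi>"
proof -
  let ?V = "{\<psi> \<in> states d. cas d U \<psi> = cscale (of_nat k * (of_nat k + 2) / 4) \<psi>}"
  have "cfun.subspace ?V"
    by (auto simp: cfun.subspace_def states_add states_scale states_0 cas_add cas_scale cas_0
        cfun.scale_right_distrib mult.commute)
  moreover have "{T a |T a. equivariant d U k T \<and> a \<le> k} \<subseteq> ?V"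
    by (auto simp: cas_equivariant) (auto simp: equivariant_def)
  ultimately have "coupled d U k \<subseteq> ?V"
    unfolding coupled_def by (intro cfun.span_minimal)
  with assms show ?thesis by auto
qed

lemma coupled_subspace: "cfun.subspace (coupled d U k)"
  by (simp add: coupled_def)

text \<open>\<open>weight_vector_coupled\<close> uses this to descend the ladder.\<close>

lemma coupled_M:
  assumes "\<psi> \<in> coupled d U k"
  shows "tot d U Mf \<psi> \<in> coupled d U k"
proof -
  have "cfun.subspace {\<psi>. tot d U Mf \<psi> \<in> coupled d U k}"
    using coupled_subspace[of d U k]
    by (auto simp: cfun.subspace_def tot_add tot_scale tot_0)
  moreover have "tot d U Mf (T a) \<in> coupled d U k" if "equivariant d U k T" "a \<le> k" for T a
  proof -
    have "tot d U Mf (T a) = (\<Sum>b\<le>k. cscale (Mf k b a) (T b))"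
      using equivariant_imp_lie(3)[OF that(1)] that(2) by (simp add: lie_def)
    also have "\<dots> \<in> coupled d U k"
      unfolding coupled_def using that
      by (intro cfun.span_sum cfun.span_scale cfun.span_base) auto
    finally show ?thesis .
  qed
  ultimately have "coupled d U k \<subseteq> {\<psi>. tot d U Mf \<psi> \<in> coupled d U k}"
    unfolding coupled_def[of d U k] by (intro cfun.span_minimal) (auto simp: coupled_def)
  with assms show ?thesis by auto
qed

text \<open>The index b is an integer because raising and lowering may leave the range;
  \<open>wv_bounds\<close> confines it to 0..k for nonzero v.\<close>

definition wv :: "(leg \<Rightarrow> nat) \<Rightarrow> leg set \<Rightarrow> nat \<Rightarrow> int \<Rightarrow> state \<Rightarrow> bool" where
  "wv d U k b v \<longleftrightarrow> v \<in> states d \<and> tot d U Zf v = cscale (of_int b - of_nat k / 2) v \<and>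
     cas d U v = cscale (of_nat k * (of_nat k + 2) / 4) v"

lemma wv_P: "wv d U k b v \<Longrightarrow> wv d U k (b + 1) (tot d U Pf v)"
  by (simp add: wv_def tot_states tot_ZP cas_comm_P[symmetric] tot_scale)
     (simp add: fun_eq_iff algebra_simps)

lemma wv_M: "wv d U k b v \<Longrightarrow> wv d U k (b - 1) (tot d U Mf v)"
  by (simp add: wv_def tot_states tot_ZM cas_comm_M[symmetric] tot_scale)
     (simp add: fun_eq_iff algebra_simps)

lemma wv_scale: "wv d U k b v \<Longrightarrow> wv d U k b (cscale c v)"
  by (simp add: wv_def states_scale tot_scale cas_scale mult.commute)

text \<open>The factor is j(j + 1) - m(m + 1) for j = k/2 and m = b - k/2; in \<open>wv_PM\<close>
  it is j(j + 1) - m(m - 1).\<close>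

lemma wv_MP:
  assumes "wv d U k b v"
  shows "tot d U Mf (tot d U Pf v) = cscale (of_int ((b + 1) * (int k - b))) v"
proof -
  have "tot d U Mf (tot d U Pf v) = cas d U v - tot d U Zf (tot d U Zf v) - tot d U Zf v"
    by (simp add: cas_def)
  also have "\<dots> = cscale (of_int ((b + 1) * (int k - b))) v"
    using assms by (simp add: wv_def tot_scale) (simp add: fun_eq_iff field_simps)
  finally show ?thesis .
qed

lemma wv_PM:
  assumes "wv d U k b v"
  shows "tot d U Pf (tot d U Mf v) = cscale (of_int (b * (int k - b + 1))) v"
proof -
  have "tot d U Zf v = cscale (of_int b - of_nat k / 2) v" using assms by (simp add: wv_def)
  then show ?thesis
    by (simp only: tot_PM wv_MP[OF assms]) (simp add: fun_eq_iff field_simps)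
qed

lemma states_cinner_0:
  assumes "\<psi> \<in> states d" "cinner (configs d) \<psi> \<psi> = 0"
  shows "\<psi> = 0"
  using assms by (intro cinner_self_eq_0[of "configs d"]) (auto simp: states_def)

lemma wv_norm_P:
  assumes "wv d U k b v"
  shows "cinner (configs d) (tot d U Pf v) (tot d U Pf v) =
    of_int ((b + 1) * (int k - b)) * cinner (configs d) v v"
  using assms by (simp only: cinner_tot_P) (simp add: wv_MP cinner_scale_left)

lemma wv_norm_M:
  assumes "wv d U k b v"
  shows "cinner (configs d) (tot d U Mf v) (tot d U Mf v) =
    of_int (b * (int k - b + 1)) * cinner (configs d) v v"
  using assms by (simp only: cinner_tot_M) (simp add: wv_PM cinner_scale_left)

text \<open>The squared norms of J_+ v and J_- v are nonnegative: the first forces -1 \<le> b \<le>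
  k, the second 0 \<le> b \<le> k + 1.\<close>

lemma wv_bounds:
  assumes "wv d U k b v" "v \<noteq> 0"
  shows "0 \<le> b" "b \<le> int k"
proof -
  define nn where "nn f = (\<Sum>x\<in>configs d. (cmod (f x))\<^sup>2)" for f :: state
  have nn: "cinner (configs d) f f = of_real (nn f)" for f by (simp add: nn_def cinner_self)
  have nn0: "nn f \<ge> 0" for f by (simp add: nn_def sum_nonneg)
  have "nn v \<noteq> 0" using states_cinner_0[of v d] assms by (auto simp: wv_def nn)
  then have v: "nn v > 0" using nn0[of v] by simp
  have "complex_of_real (nn (tot d U Pf v)) = of_real (of_int ((b + 1) * (int k - b)) * nn v)"
    using wv_norm_P[OF assms(1)] by (simp add: nn)
  then have "of_int ((b + 1) * (int k - b)) * nn v \<ge> 0"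
    using nn0[of "tot d U Pf v"] unfolding of_real_eq_iff by simp
  then have 1: "(b + 1) * (int k - b) \<ge> 0"
    using v by (simp add: zero_le_mult_iff del: of_int_mult)
  have "complex_of_real (nn (tot d U Mf v)) = of_real (of_int (b * (int k - b + 1)) * nn v)"
    using wv_norm_M[OF assms(1)] by (simp add: nn)
  then have "of_int (b * (int k - b + 1)) * nn v \<ge> 0"
    using nn0[of "tot d U Mf v"] unfolding of_real_eq_iff by simp
  then have 2: "b * (int k - b + 1) \<ge> 0"
    using v by (simp add: zero_le_mult_iff del: of_int_mult)
  show "0 \<le> b" using 2 by (auto simp: zero_le_mult_iff)
  show "b \<le> int k" using 1 by (auto simp: zero_le_mult_iff)
qed

lemma wv_top: "wv d U k (int k) v \<Longrightarrow> tot d U Pf v = 0"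
  using wv_norm_P[of d U k "int k" v] by (intro states_cinner_0[of _ d]) (auto simp: wv_def tot_states)

lemma wv_bot: "wv d U k 0 v \<Longrightarrow> tot d U Mf v = 0"
  using wv_norm_M[of d U k 0 v] by (intro states_cinner_0[of _ d]) (auto simp: wv_def tot_states)

lemma sum_Mf:
  fixes f :: "nat \<Rightarrow> state"
  assumes "a \<le> k"
  shows "(\<Sum>b\<le>k. cscale (Mf k b a) (f b)) =
    (if a = 0 then 0 else cscale (of_real (sqrt (real a * (real k + 1 - real a)))) (f (a - 1)))"
proof -
  have "(\<Sum>b\<le>k. cscale (Mf k b a) (f b)) = (\<Sum>b\<le>k. if b = a - 1 then
      (if a = 0 then 0 else cscale (of_real (sqrt (real a * (real k + 1 - real a)))) (f (a - 1))) else 0)"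
    by (intro sum.cong refl) (auto simp: Mf_def)
  then show ?thesis using assms by auto
qed

lemma sum_Pf:
  fixes f :: "nat \<Rightarrow> state"
  assumes "a \<le> k"
  shows "(\<Sum>b\<le>k. cscale (Pf k b a) (f b)) =
    (if a = k then 0 else cscale (of_real (sqrt (real (Suc a) * (real k - real a)))) (f (Suc a)))"
proof -
  have "(\<Sum>b\<le>k. cscale (Pf k b a) (f b)) = (\<Sum>b\<le>k. if b = Suc a then
      cscale (of_real (sqrt (real (Suc a) * (real k - real a)))) (f (Suc a)) else 0)"
    by (intro sum.cong refl) (auto simp: Pf_def)
  then show ?thesis using assms by auto
qed

lemma sum_Zf:
  fixes f :: "nat \<Rightarrow> state"
  assumes "a \<le> k"
  shows "(\<Sum>b\<le>k. cscale (Zf k b a) (f b)) = cscale (of_real (real a - real k / 2)) (f a)"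
proof -
  have "(\<Sum>b\<le>k. cscale (Zf k b a) (f b)) =
      (\<Sum>b\<le>k. if b = a then cscale (of_real (real a - real k / 2)) (f a) else 0)"
    by (intro sum.cong refl) (auto simp: Zf_def)
  then show ?thesis using assms by auto
qed

text \<open>Lowering v repeatedly and normalizing each step reproduces the standard basis of spin
  k/2, which is an equivariant family with \<open>T k\<close> = v.\<close>

lemma highest_weight_coupled:
  assumes v: "wv d U k (int k) v"
  shows "v \<in> coupled d U k"
proof -
  \<comment> \<open>The matrix element of J_- from index k - r to k - r - 1; it vanishes at r = k,
    where the ladder ends.\<close>
  define s where "s r = complex_of_real (sqrt ((real k - real r) * (real r + 1)))" for r
  have s2: "s r * s r = (of_nat k - of_nat r) * (of_nat r + 1)" if "r \<le> k" for r
    using that by (simp add: s_def sqrt_of_real_square)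
  have s0: "s r \<noteq> 0" if "r < k" for r using that by (simp add: s_def)
  define t where "t = rec_nat v (\<lambda>r x. cscale (1 / s r) (tot d U Mf x))"
  have t0: "t 0 = v" and tS: "t (Suc r) = cscale (1 / s r) (tot d U Mf (t r))" for r
    by (simp_all add: t_def)
  have t: "wv d U k (int k - int r) (t r)" for r
  proof (induction r)
    case (Suc r)
    have "int k - int (Suc r) = int k - int r - 1" by simp
    then show ?case unfolding tS by (metis Suc.IH wv_M wv_scale)
  qed (simp add: t0 v)
  define T where "T a = t (k - a)" for a
  have T: "wv d U k (int a) (T a)" if "a \<le> k" for a
    using t[of "k - a"] that by (simp add: T_def of_nat_diff)
  have "lie d U k T Zf"
    using T by (simp add: lie_def sum_Zf wv_def)
  moreover have "lie d U k T Mf"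
    unfolding lie_def
  proof (intro allI impI)
    fix a assume a: "a \<le> k"
    show "tot d U Mf (T a) = (\<Sum>b\<le>k. cscale (Mf k b a) (T b))"
    proof (cases "a = 0")
      case True
      then show ?thesis using wv_bot[of d U k "T 0"] T[of 0] by (simp add: sum_Mf)
    next
      case False
      have "k - (a - 1) = Suc (k - a)" using a False by simp
      then have "T (a - 1) = cscale (1 / s (k - a)) (tot d U Mf (T a))" by (simp add: T_def tS)
      moreover have "s (k - a) = of_real (sqrt (real a * (real k + 1 - real a)))"
        using a by (simp add: s_def of_nat_diff algebra_simps)
      moreover have "s (k - a) \<noteq> 0" using a False by (intro s0) simp
      ultimately show ?thesis using a False by (simp add: sum_Mf)
    qed
  qed
  moreover have "lie d U k T Pf"
    unfolding lie_def
  proof (intro allI impI)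
    fix a assume a: "a \<le> k"
    show "tot d U Pf (T a) = (\<Sum>b\<le>k. cscale (Pf k b a) (T b))"
    proof (cases "a = k")
      case True
      then show ?thesis using wv_top[of d U k "T k"] T[of k] by (simp add: sum_Pf)
    next
      case False
      define r where "r = k - Suc a"
      have r: "k - a = Suc r" "int k - int r = int a + 1" "r < k" "r \<le> k"
        and kr: "of_nat r = (of_nat k - of_nat a - 1 :: complex)"
        using a False by (auto simp: r_def of_nat_diff)
      have "tot d U Pf (T a) = cscale (1 / s r) (tot d U Pf (tot d U Mf (t r)))"
        by (simp add: T_def r tS tot_scale)
      also have "\<dots> = cscale (1 / s r * (s r * s r)) (t r)"
        using wv_PM[OF t[of r]] by (simp add: s2 r) (simp add: kr algebra_simps)
      also have "1 / s r * (s r * s r) = s r" using s0[OF r(3)] by simp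
      also have "s r = of_real (sqrt (real (Suc a) * (real k - real a)))"
        using a False by (simp add: s_def r_def of_nat_diff algebra_simps)
      also have "t r = T (Suc a)" by (simp add: T_def r_def)
      finally show ?thesis using a False by (simp only: sum_Pf if_False)
    qed
  qed
  ultimately have "equivariant d U k T"
    using T by (simp add: equivariant_iff wv_def)
  then have "T k \<in> coupled d U k"
    unfolding coupled_def by (intro cfun.span_base) blast
  then show ?thesis by (simp add: T_def t0)
qed

text \<open>Induction on the distance from the top weight: J_+ v is one step higher, and J_- J_+ v
  is a multiple of v with a factor that is nonzero for 0 \<le> b < k.\<close>

lemma weight_vector_coupled:
  assumes "wv d U k b v"
  shows "v \<in> coupled d U k"
proof (cases "v = 0")
  case True
  then show ?thesis using coupled_subspace by (simp add: cfun.subspace_0)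
next
  case False
  have "0 \<le> b" "b \<le> int k" using wv_bounds[OF assms False] by auto
  then obtain n where n: "b = int k - int n" "n \<le> k"
    by (metis diff_diff_eq2 diff_ge_0_iff_ge add_diff_cancel_left' nat_0_le of_nat_le_iff diff_left_mono diff_zero)
  show ?thesis using assms n
  proof (induction n arbitrary: b v)
    case 0
    then show ?case using highest_weight_coupled by simp
  next
    case (Suc n)
    have b: "b + 1 = int k - int n" "b \<ge> 0" "b < int k" using Suc.prems by auto
    then have "tot d U Pf v \<in> coupled d U k"
      using Suc.prems by (intro Suc.IH[of "b + 1"] wv_P) auto
    then have "cscale (1 / of_int ((b + 1) * (int k - b))) (tot d U Mf (tot d U Pf v)) \<in> coupled d U k"
      using coupled_subspace coupled_M by (blast intro: cfun.subspace_scale)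
    moreover have "of_int ((b + 1) * (int k - b)) \<noteq> (0 :: complex)"
      using b by (simp only: of_int_eq_0_iff) simp
    ultimately show ?case using wv_MP[OF Suc.prems(1)] by (simp del: of_int_mult)
  qed
qed

text \<open>J_z is diagonal in the magnetic indices; on states this is the component with J_z
  eigenvalue w - n/2 on the legs in \<open>U\<close>, where n is the sum of their doubled
  spins.\<close>

definition wpart :: "leg set \<Rightarrow> int \<Rightarrow> state \<Rightarrow> state" where
  "wpart U w \<psi> m = (if int (\<Sum>i\<in>U. m i) = w then \<psi> m else 0)"

lemma legop_wpart:
  assumes "i \<in> U" and N: "\<And>n b c. N n b c \<noteq> 0 \<Longrightarrow> int b = int c + s"
  shows "legop d i N (wpart U w \<psi>) = wpart U (w + s) (legop d i N \<psi>)"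
proof
  fix m
  have "int (\<Sum>j\<in>U. (m(i := c)) j) = int (\<Sum>j\<in>U. m j) - int (m i) + int c" for c
  proof -
    have "(\<Sum>j\<in>U - {i}. (m(i := c)) j) = (\<Sum>j\<in>U - {i}. m j)" by (intro sum.cong) auto
    then have "(\<Sum>j\<in>U. (m(i := c)) j) = c + (\<Sum>j\<in>U - {i}. m j)"
      by (subst sum.remove[of _ i]) (use assms(1) in auto)
    moreover have "(\<Sum>j\<in>U. m j) = m i + (\<Sum>j\<in>U - {i}. m j)"
      by (rule sum.remove) (use assms(1) in auto)
    ultimately show ?thesis by simp
  qed
  then have "N (d i) (m i) c * wpart U w \<psi> (m(i := c)) =
     (if int (\<Sum>j\<in>U. m j) = w + s then N (d i) (m i) c * \<psi> (m(i := c)) else 0)" for c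
    using N[of "d i" "m i" c] by (cases "N (d i) (m i) c = 0") (auto simp: wpart_def)
  then show "legop d i N (wpart U w \<psi>) m = wpart U (w + s) (legop d i N \<psi>) m"
    by (auto simp: legop_def wpart_def)
qed

lemma wpart_sum: "wpart U w (sum f X) = (\<Sum>x\<in>X. wpart U w (f x))"
  by (auto simp: wpart_def fun_eq_iff sum_fun_apply)

lemma tot_wpart:
  assumes "\<And>n b c. N n b c \<noteq> 0 \<Longrightarrow> int b = int c + s"
  shows "tot d U N (wpart U w \<psi>) = wpart U (w + s) (tot d U N \<psi>)"
  unfolding tot_def wpart_sum using assms by (intro sum.cong refl legop_wpart) auto

lemma legop_Z:
  assumes "\<psi> \<in> states d"
  shows "legop d i Zf \<psi> m = of_real (real (m i) - real (d i) / 2) * \<psi> m"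
proof (cases "m i \<le> d i")
  case True
  have "(\<Sum>c\<le>d i. Zf (d i) (m i) c * \<psi> (m(i := c))) =
      (\<Sum>c\<le>d i. if c = m i then of_real (real (m i) - real (d i) / 2) * \<psi> m else 0)"
    by (intro sum.cong) (auto simp: Zf_def)
  then show ?thesis using True by (simp add: legop_def)
next
  case False
  then have "\<psi> m = 0" using assms by (auto simp: states_def configs_def)
  then show ?thesis using False by (simp add: legop_def)
qed

lemma wpart_states: "\<psi> \<in> states d \<Longrightarrow> wpart U w \<psi> \<in> states d"
  by (auto simp: states_def wpart_def)

lemma tot_Z_apply:
  assumes "\<psi> \<in> states d"
  shows "tot d U Zf \<psi> m = of_real (real (\<Sum>i\<in>U. m i) - real (\<Sum>i\<in>U. d i) / 2) * \<psi> m"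
proof -
  have "tot d U Zf \<psi> m = of_real (\<Sum>i\<in>U. real (m i) - real (d i) / 2) * \<psi> m"
    by (simp only: tot_def sum_fun_apply legop_Z[OF assms] of_real_sum sum_distrib_right)
  also have "(\<Sum>i\<in>U. real (m i) - real (d i) / 2) = real (\<Sum>i\<in>U. m i) - real (\<Sum>i\<in>U. d i) / 2"
    by (simp add: sum_subtractf sum_divide_distrib)
  finally show ?thesis .
qed

text \<open>Splitting \<psi> by weight preserves the Casimir value, so each component is a weight
  vector and therefore coupled. The parity hypothesis makes the weight index an integer.\<close>

theorem coupled_iff_cas:
  assumes "\<psi> \<in> states d" "even (k + (\<Sum>i\<in>U. d i))"
    and cas: "cas d U \<psi> = cscale (of_nat k * (of_nat k + 2) / 4) \<psi>"
  shows "\<psi> \<in> coupled d U k"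
proof -
  define n where "n = (\<Sum>i\<in>U. d i)"
  have wp: "tot d U Pf (wpart U w \<psi>) = wpart U (w + 1) (tot d U Pf \<psi>)"
    "tot d U Zf (wpart U w \<psi>) = wpart U w (tot d U Zf \<psi>)"
    "tot d U Mf (wpart U w \<psi>) = wpart U (w - 1) (tot d U Mf \<psi>)" for w \<psi>
    using tot_wpart[of Pf 1 d U w \<psi>] tot_wpart[of Zf 0 d U w \<psi>] tot_wpart[of Mf "-1" d U w \<psi>]
    by (auto simp: Pf_def Zf_def Mf_def split: if_splits)
  \<comment> \<open>The index b solves w - n/2 = b - k/2.\<close>
  have "wv d U k (w + (int k - int n) div 2) (wpart U w \<psi>)" for w
    unfolding wv_def
  proof (intro conjI)
    show "wpart U w \<psi> \<in> states d" by (rule wpart_states[OF assms(1)])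
    have "cas d U (wpart U w \<psi>) = wpart U w (cas d U \<psi>)"
      by (simp add: cas_def wp) (simp add: wpart_def fun_eq_iff)
    then show "cas d U (wpart U w \<psi>) = cscale (of_nat k * (of_nat k + 2) / 4) (wpart U w \<psi>)"
      by (simp add: cas) (simp add: wpart_def fun_eq_iff)
    obtain r where "k + n = 2 * r" using assms(2) unfolding n_def by (rule evenE)
    then have "int k + int n = 2 * int r" by (metis of_nat_add of_nat_mult of_nat_numeral)
    then have "int k - int n = 2 * (int r - int n)" by (simp add: algebra_simps)
    then obtain q where "int k - int n = 2 * q" by blast
    then have q: "int k = 2 * q + int n" "(int k - int n) div 2 = q" by auto
    have "complex_of_int (int k) = of_int (2 * q + int n)" by (simp only: q)
    then have kc: "(of_nat k :: complex) = 2 * of_int q + of_nat n" by simp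
    have "tot d U Zf (wpart U w \<psi>) m = cscale (of_int (w + (int k - int n) div 2) - of_nat k / 2) (wpart U w \<psi>) m" for m
      unfolding tot_Z_apply[OF wpart_states[OF assms(1)]] q kc
      by (auto simp: wpart_def n_def field_simps simp del: of_nat_sum)
    then show "tot d U Zf (wpart U w \<psi>) = cscale (of_int (w + (int k - int n) div 2) - of_nat k / 2) (wpart U w \<psi>)"
      by (rule ext)
  qed
  then have "(\<Sum>w\<in>{0..int n}. wpart U w \<psi>) \<in> coupled d U k"
    using coupled_subspace weight_vector_coupled by (blast intro: cfun.subspace_sum)
  moreover have "(\<Sum>w\<in>{0..int n}. wpart U w \<psi>) = \<psi>"
  proof
    fix m
    show "(\<Sum>w\<in>{0..int n}. wpart U w \<psi>) m = \<psi> m"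
    proof (cases "m \<in> configs d")
      case True
      then have "(\<Sum>i\<in>U. m i) \<le> n" unfolding n_def by (intro sum_mono) (simp add: configs_def)
      then show ?thesis by (simp add: sum_fun_apply wpart_def del: of_nat_sum)
    next
      case False
      then have "\<psi> m = 0" using assms(1) by (simp add: states_def)
      then show ?thesis by (simp add: sum_fun_apply wpart_def)
    qed
  qed
  ultimately show ?thesis by simp
qed


section \<open>Spin operators at a vertex\<close>

text \<open>\<open>dot d i j\<close> is \<open>2 J\<^sub>i \<cdot> J\<^sub>j\<close>, and hence \<open>\<sigma> \<cdot> J\<^sub>j\<close> if \<open>i\<close> is the fermion.\<close>

definition dot :: "(leg \<Rightarrow> nat) \<Rightarrow> leg \<Rightarrow> leg \<Rightarrow> state \<Rightarrow> state" where
  "dot d i j \<psi> = cscale 2 (legop d i Zf (legop d j Zf \<psi>))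
     + legop d i Pf (legop d j Mf \<psi>) + legop d i Mf (legop d j Pf \<psi>)"

lemma tot_singleton: "tot d {i} N \<psi> = legop d i N \<psi>"
  by (simp add: tot_def)

lemma tot_insert: "i \<notin> U \<Longrightarrow> tot d (insert i U) N \<psi> = legop d i N \<psi> + tot d U N \<psi>"
  by (simp add: tot_def)

lemma legop_tot_commute: "i \<notin> U \<Longrightarrow> tot d U N (legop d i N' \<psi>) = legop d i N' (tot d U N \<psi>)"
  using tot_commute[of U "{i}" d N N' \<psi>] by (simp add: tot_singleton)

lemma cas_singleton:
  assumes "\<psi> \<in> states d"
  shows "cas d {i} \<psi> = cscale (of_nat (d i) * (of_nat (d i) + 2) / 4) \<psi>"
proof -
  have "cas d {i} \<psi> = legop d i (\<lambda>n b c. fmul Mf Pf n b c + fmul Zf Zf n b c + Zf n b c) \<psi>"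
    by (simp only: cas_def tot_singleton legop_mult legop_family_add)
  also have "\<dots> = legop d i (\<lambda>n b c. if b = c then of_nat n * (of_nat n + 2) / 4 else 0) \<psi>"
    by (rule legop_cong) (rule casimir_family)
  also have "\<dots> = cscale (of_nat (d i) * (of_nat (d i) + 2) / 4) \<psi>"
    by (rule legop_scalar[OF assms])
  finally show ?thesis .
qed

text \<open>Expansion of (J_i + J_U)^2, with cross terms 2 J_i . J_j for j in
  \<open>U\<close>.\<close>

lemma cas_insert:
  assumes "\<psi> \<in> states d" "i \<notin> U"
  shows "cas d (insert i U) \<psi> =
    cas d U \<psi> + cscale (of_nat (d i) * (of_nat (d i) + 2) / 4) \<psi> + (\<Sum>j\<in>U. dot d i j \<psi>)"
proof -
  have "(\<Sum>j\<in>U. dot d i j \<psi>) = cscale 2 (legop d i Zf (tot d U Zf \<psi>))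
     + legop d i Pf (tot d U Mf \<psi>) + legop d i Mf (tot d U Pf \<psi>)"
    by (simp add: dot_def sum.distrib tot_def legop_sum cfun.scale_sum_right)
  moreover have "cscale 2 \<phi> = \<phi> + \<phi>" for \<phi> :: state by (simp add: fun_eq_iff)
  ultimately show ?thesis
    unfolding cas_singleton[OF assms(1), symmetric]
    by (simp add: cas_def tot_insert[OF assms(2)] tot_singleton tot_add legop_add legop_tot_commute[OF assms(2)])
qed

lemma legop_ZP: "legop d i Zf (legop d i Pf \<psi>) = legop d i Pf (legop d i Zf \<psi>) + legop d i Pf \<psi>"
  and legop_ZM: "legop d i Zf (legop d i Mf \<psi>) = legop d i Mf (legop d i Zf \<psi>) - legop d i Mf \<psi>"
  and legop_PM: "legop d i Pf (legop d i Mf \<psi>) = legop d i Mf (legop d i Pf \<psi>) + cscale 2 (legop d i Zf \<psi>)"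
  using tot_ZP[of d "{i}" \<psi>] tot_ZM[of d "{i}" \<psi>] tot_PM[of d "{i}" \<psi>] by (simp_all only: tot_singleton)

lemma legop_MP:
  assumes "\<psi> \<in> states d"
  shows "legop d i Mf (legop d i Pf \<psi>) =
    cscale (of_nat (d i) * (of_nat (d i) + 2) / 4) \<psi> - legop d i Zf (legop d i Zf \<psi>) - legop d i Zf \<psi>"
  unfolding cas_singleton[OF assms, symmetric] by (simp add: cas_def tot_singleton)

context
  fixes d :: "leg \<Rightarrow> nat"
  assumes F: "d Fermion = 1"
begin

text \<open>The Pauli relations: products of two spin-1/2 matrices are again combinations of spin
  matrices and the identity.\<close>

lemma fermion_mult:
  assumes "\<psi> \<in> states d"
  shows "legop d Fermion Zf (legop d Fermion Zf \<psi>) = cscale (1/4) \<psi>"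
    and "legop d Fermion Zf (legop d Fermion Pf \<psi>) = cscale (1/2) (legop d Fermion Pf \<psi>)"
    and "legop d Fermion Pf (legop d Fermion Zf \<psi>) = cscale (-1/2) (legop d Fermion Pf \<psi>)"
    and "legop d Fermion Zf (legop d Fermion Mf \<psi>) = cscale (-1/2) (legop d Fermion Mf \<psi>)"
    and "legop d Fermion Mf (legop d Fermion Zf \<psi>) = cscale (1/2) (legop d Fermion Mf \<psi>)"
    and "legop d Fermion Pf (legop d Fermion Pf \<psi>) = 0"
    and "legop d Fermion Mf (legop d Fermion Mf \<psi>) = 0"
    and "legop d Fermion Pf (legop d Fermion Mf \<psi>) = cscale (1/2) \<psi> + legop d Fermion Zf \<psi>"
    and "legop d Fermion Mf (legop d Fermion Pf \<psi>) = cscale (1/2) \<psi> - legop d Fermion Zf \<psi>"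
proof -
  have le: "b = 0 \<or> b = 1" if "b \<le> d Fermion" for b using that F by auto
  note s = legop_scalar[OF assms, of Fermion, symmetric] legop_family_scale[symmetric]
    legop_family_add[symmetric] legop_mult
  show "legop d Fermion Zf (legop d Fermion Zf \<psi>) = cscale (1/4) \<psi>"
    unfolding s(1)[of "\<lambda>_. 1/4"] legop_mult
    by (rule legop_cong) (auto simp: fmul_Z Zf_def F le_Suc_eq)
  show "legop d Fermion Zf (legop d Fermion Pf \<psi>) = cscale (1/2) (legop d Fermion Pf \<psi>)"
    unfolding s(2) legop_mult by (rule legop_cong) (auto dest!: le simp: fmul_Z Pf_def F)
  show "legop d Fermion Pf (legop d Fermion Zf \<psi>) = cscale (-1/2) (legop d Fermion Pf \<psi>)"
    unfolding s(2) legop_mult by (rule legop_cong) (auto dest!: le simp: fmul_Z_right Pf_def F)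
  show "legop d Fermion Zf (legop d Fermion Mf \<psi>) = cscale (-1/2) (legop d Fermion Mf \<psi>)"
    unfolding s(2) legop_mult by (rule legop_cong) (auto dest!: le simp: fmul_Z Mf_def F)
  show "legop d Fermion Mf (legop d Fermion Zf \<psi>) = cscale (1/2) (legop d Fermion Mf \<psi>)"
    unfolding s(2) legop_mult by (rule legop_cong) (auto dest!: le simp: fmul_Z_right Mf_def F)
  have z: "legop d Fermion N \<psi> = 0" if "\<And>b c. b \<le> d Fermion \<Longrightarrow> c \<le> d Fermion \<Longrightarrow> N (d Fermion) b c = 0" for N
    using that by (auto simp: legop_def fun_eq_iff)
  show "legop d Fermion Pf (legop d Fermion Pf \<psi>) = 0" "legop d Fermion Mf (legop d Fermion Mf \<psi>) = 0"
    unfolding legop_mult by (rule z; auto simp: fmul_def Pf_def Mf_def F)+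
  show MP: "legop d Fermion Mf (legop d Fermion Pf \<psi>) = cscale (1/2) \<psi> - legop d Fermion Zf \<psi>"
    unfolding legop_MP[OF assms] \<open>legop d Fermion Zf (legop d Fermion Zf \<psi>) = cscale (1/4) \<psi>\<close>
    by (simp add: fun_eq_iff F algebra_simps)
  show "legop d Fermion Pf (legop d Fermion Mf \<psi>) = cscale (1/2) \<psi> + legop d Fermion Zf \<psi>"
    unfolding legop_PM MP by (simp add: fun_eq_iff algebra_simps)
qed

text \<open>Let L be the spin of the edge. The symmetric part of the Pauli products yields L^2; the
  antisymmetric part meets the commutator of the components of L and yields -\<sigma> . L.\<close>

lemma dot_fermion_square:
  assumes "\<psi> \<in> states d" "e \<noteq> Fermion"
  shows "dot d Fermion e (dot d Fermion e \<psi>) =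
    cscale (of_nat (d e) * (of_nat (d e) + 2) / 4) \<psi> - dot d Fermion e \<psi>"
proof -
  note c = legop_commute[OF assms(2)]
  note st = assms(1) legop_states
  show ?thesis
    unfolding dot_def
    by (simp only: legop_add legop_diff legop_scale c fermion_mult st legop_ZP legop_ZM
          legop_PM legop_MP[OF assms(1)])
       (simp add: F legop_0 fun_eq_iff field_simps)
qed

text \<open>Spins of different edges commute, so the antisymmetric parts of the Pauli products
  cancel.\<close>

lemma dot_fermion_anticommute:
  assumes "\<psi> \<in> states d" "e \<noteq> Fermion" "e' \<noteq> Fermion" "e' \<noteq> e"
  shows "dot d Fermion e (dot d Fermion e' \<psi>) + dot d Fermion e' (dot d Fermion e \<psi>) = dot d e e' \<psi>"
proof -
  note c = legop_commute[OF assms(2)] legop_commute[OF assms(3)] legop_commute[OF assms(4)]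
  note st = assms(1) legop_states
  show ?thesis
    unfolding dot_def
    by (simp only: legop_add legop_scale c fermion_mult st)
       (simp add: legop_0 fun_eq_iff algebra_simps)
qed

end


section \<open>Casimir operators on invariant states\<close>

lemma intertwiners_states: "\<psi> \<in> intertwiners d \<Longrightarrow> \<psi> \<in> states d"
  by (simp add: intertwiners_iff)

lemma intertwiners_subspace: "cfun.subspace (intertwiners d)"
  by (auto simp: cfun.subspace_def intertwiners_iff states_add states_scale states_0 tot_add
      tot_scale tot_0)

lemma intertwiners_add: "\<phi> \<in> intertwiners d \<Longrightarrow> \<psi> \<in> intertwiners d \<Longrightarrow> \<phi> + \<psi> \<in> intertwiners d"
  and intertwiners_scale: "\<psi> \<in> intertwiners d \<Longrightarrow> cscale c \<psi> \<in> intertwiners d"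
  and intertwiners_0: "0 \<in> intertwiners d"
  using intertwiners_subspace by (auto simp: cfun.subspace_def)

lemma tot_split: "tot d UNIV N \<psi> = tot d U N \<psi> + tot d (- U) N \<psi>"
  using tot_union[of U "- U" d N \<psi>] by simp

text \<open>Invariance means that the spins of U and of its complement are opposite on \<psi>. Using
  this twice reverses the order of factors, and J_+ J_- = J_- J_+ + 2 J_z compensates the changed
  sign of the linear term.\<close>

lemma cas_complement:
  assumes "\<psi> \<in> intertwiners d"
  shows "cas d U \<psi> = cas d (- U) \<psi>"
proof -
  have neg: "tot d U N \<psi> = - tot d (- U) N \<psi>" if "N \<in> {Zf, Pf, Mf}" for N
    using assms that tot_split[of d N \<psi> U] by (auto simp: intertwiners_iff add_eq_0_iff)
  have m: "tot d V N (- \<phi>) = - tot d V N \<phi>" for V N \<phi>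
    using tot_diff[of d V N 0 \<phi>] by (simp add: tot_0)
  have c: "tot d U N (tot d (- U) N' \<psi>) = - tot d (- U) N' (tot d (- U) N \<psi>)"
    if "N \<in> {Zf, Pf, Mf}" for N N'
    using tot_commute[of U "- U" d N N' \<psi>] neg[OF that] by (simp add: m)
  show ?thesis
    unfolding cas_def by (simp add: neg m c tot_PM) (simp add: fun_eq_iff)
qed

lemma cas_intertwiners:
  assumes "\<psi> \<in> intertwiners d"
  shows "cas d U \<psi> \<in> intertwiners d"
proof -
  have "tot d UNIV N (cas d U \<psi>) = 0" if N: "N \<in> {Zf, Pf, Mf}" for N
  proof -
    have "tot d UNIV N (cas d U \<psi>) = cas d U (tot d UNIV N \<psi>)"
      unfolding tot_split[of d N _ U] cas_add
      using N cas_comm_Z cas_comm_P cas_comm_M cas_comm_disjoint[of U "- U"] by auto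
    then show ?thesis using assms N by (auto simp: intertwiners_iff cas_0)
  qed
  then show ?thesis using assms by (simp add: intertwiners_iff cas_states)
qed

text \<open>On intertwiners, \<open>gop d e\<close> is the sign of \<open>k - d e\<close>, where \<open>k/2\<close> is the total spin of the fermion
  and the edge \<open>e\<close>: it is \<open>(\<sigma> \<cdot> J\<^sub>e + 1/2) / (j\<^sub>e + 1/2)\<close> for the Pauli matrices \<open>\<sigma>\<close> of the fermion.\<close>

definition gop :: "(leg \<Rightarrow> nat) \<Rightarrow> leg \<Rightarrow> state \<Rightarrow> state" where
  "gop d e \<psi> = cscale (1 / of_real (J (d e))) (dot d Fermion e \<psi> + cscale (1/2) \<psi>)"

lemma J_pos: "J n > 0"
  by (simp add: J_def)

lemma J_square: "(complex_of_real (J n))\<^sup>2 = of_nat n * (of_nat n + 2) / 4 + 1/4"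
  by (simp add: J_def power2_eq_square field_simps)

lemma dot_add: "dot d i j (\<phi> + \<psi>) = dot d i j \<phi> + dot d i j \<psi>"
  and dot_scale: "dot d i j (cscale c \<psi>) = cscale c (dot d i j \<psi>)"
  by (simp_all add: dot_def legop_add legop_scale)
     (simp_all add: fun_eq_iff algebra_simps)

lemma gop_add: "gop d e (\<phi> + \<psi>) = gop d e \<phi> + gop d e \<psi>"
  and gop_scale: "gop d e (cscale c \<psi>) = cscale c (gop d e \<psi>)"
  by (simp_all add: gop_def dot_add dot_scale) (simp_all add: fun_eq_iff algebra_simps)

text \<open>The fermion contributes its Casimir 3/4 = 1/4 + 1/2: the 1/4 completes j(j + 1) to
  \<open>(J (d e))\<^sup>2\<close>, the 1/2 is the shift inside \<open>gop\<close>.\<close>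

lemma cas_fermion_pair:
  assumes "d Fermion = 1" "\<psi> \<in> states d" "e \<noteq> Fermion"
  shows "cas d {e, Fermion} \<psi> = cscale ((of_real (J (d e)))\<^sup>2) \<psi> + cscale (of_real (J (d e))) (gop d e \<psi>)"
proof -
  have "cas d {e, Fermion} \<psi> = cas d {e} \<psi> + cscale (3/4) \<psi> + dot d Fermion e \<psi>"
    using cas_insert[OF assms(2), of Fermion "{e}"] assms by (simp add: insert_commute)
  then show ?thesis
    using J_pos[of "d e"] unfolding cas_singleton[OF assms(2)] gop_def J_square
    by (simp add: fun_eq_iff algebra_simps)
qed

text \<open>The shift by 1/2 completes the square: S = \<open>dot d Fermion e\<close> satisfies S^2
  + S = j(j + 1), so (S + 1/2)^2 = j(j + 1) + 1/4.\<close>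

lemma gop_square:
  assumes "d Fermion = 1" "\<psi> \<in> states d" "e \<noteq> Fermion"
  shows "gop d e (gop d e \<psi>) = \<psi>"
proof -
  define c where "c = complex_of_real (J (d e))"
  have c: "c \<noteq> 0" "c * c = of_nat (d e) * (of_nat (d e) + 2) / 4 + 1/4"
    using J_pos[of "d e"] J_square[of "d e"] by (auto simp: c_def power2_eq_square)
  have "gop d e (gop d e \<psi>) = cscale (1 / (c * c)) (dot d Fermion e (dot d Fermion e \<psi>) + dot d Fermion e \<psi> + cscale (1/4) \<psi>)"
    by (simp add: gop_def dot_add dot_scale c_def[symmetric]) (simp add: fun_eq_iff algebra_simps)
  also have "\<dots> = cscale (1 / (c * c)) (cscale (c * c) \<psi>)"
    unfolding dot_fermion_square[OF assms] unfolding c(2) by (simp add: fun_eq_iff algebra_simps)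
  also have "\<dots> = \<psi>" using c(1) by simp
  finally show ?thesis .
qed

text \<open>\<open>gop\<close> is an affine function of a Casimir operator and inherits its
  invariance; \<open>gop_selfadjoint\<close> exploits the same form.\<close>

lemma gop_intertwiners:
  assumes "d Fermion = 1" "\<psi> \<in> intertwiners d" "e \<noteq> Fermion"
  shows "gop d e \<psi> \<in> intertwiners d"
proof -
  define c where "c = complex_of_real (J (d e))"
  have c: "c \<noteq> 0" using J_pos[of "d e"] by (simp add: c_def)
  have "gop d e \<psi> = cscale (1 / c) (cas d {e, Fermion} \<psi> + cscale (- c\<^sup>2) \<psi>)"
    using c unfolding cas_fermion_pair[OF assms(1) intertwiners_states[OF assms(2)] assms(3)] c_def[symmetric]
    by (simp add: fun_eq_iff field_simps)
  then show ?thesis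
    by (simp only: intertwiners_scale intertwiners_add cas_intertwiners assms(2))
qed

lemma gop_selfadjoint:
  assumes "d Fermion = 1" "\<psi> \<in> states d" "\<phi> \<in> states d" "e \<noteq> Fermion"
  shows "cinner (configs d) \<phi> (gop d e \<psi>) = cinner (configs d) (gop d e \<phi>) \<psi>"
proof -
  define c where "c = complex_of_real (J (d e))"
  have c: "c \<noteq> 0" "cnj c = c" using J_pos[of "d e"] by (simp_all add: c_def)
  have g: "gop d e \<psi> = cscale (1 / c) (cas d {e, Fermion} \<psi> + cscale (- c\<^sup>2) \<psi>)" if "\<psi> \<in> states d" for \<psi>
    using c unfolding cas_fermion_pair[OF assms(1) that assms(4)] c_def[symmetric]
    by (simp add: fun_eq_iff field_simps)
  show ?thesis
    by (simp only: g assms cinner_add_left cinner_add_right cinner_scale_left cinner_scale_right cinner_cas)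
       (simp add: c)
qed

lemma gop_anticommute:
  assumes "d Fermion = 1" "\<psi> \<in> intertwiners d"
  shows "gop d Edge1 (gop d Edge2 \<psi>) + gop d Edge2 (gop d Edge1 \<psi>) =
    cscale (of_real (((J (d Edge3))\<^sup>2 - (J (d Edge1))\<^sup>2 - (J (d Edge2))\<^sup>2) / (J (d Edge1) * J (d Edge2)))) \<psi>"
proof -
  define c1 where "c1 = complex_of_real (J (d Edge1))"
  define c2 where "c2 = complex_of_real (J (d Edge2))"
  define c3 where "c3 = complex_of_real (J (d Edge3))"
  have c: "c1 \<noteq> 0" "c2 \<noteq> 0" using J_pos by (simp_all add: c1_def c2_def less_imp_neq[symmetric])
  have Cas: "of_nat (d Edge1) * (of_nat (d Edge1) + 2) / 4 = c1\<^sup>2 - 1/4"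
    "of_nat (d Edge2) * (of_nat (d Edge2) + 2) / 4 = c2\<^sup>2 - 1/4"
    "of_nat (d Edge3) * (of_nat (d Edge3) + 2) / 4 = c3\<^sup>2 - 1/4"
    unfolding c1_def c2_def c3_def J_square by simp_all
  have st: "\<psi> \<in> states d" by (rule intertwiners_states[OF assms(2)])
  have "cas d {Fermion, Edge1, Edge2} \<psi> = cas d {Edge3} \<psi>"
  proof -
    have "- {Fermion, Edge1, Edge2} = {Edge3}" using UNIV_leg by auto
    then show ?thesis using cas_complement[OF assms(2), of "{Fermion, Edge1, Edge2}"] by simp
  qed
  \<comment> \<open>The constants -1/4 of the three edges and 3/4 of the fermion leave -1/2, which
    the shifts by 1/2 in the two products of \<open>gop\<close> cancel.\<close>
  then have "dot d Edge1 Edge2 \<psi> + dot d Fermion Edge1 \<psi> + dot d Fermion Edge2 \<psi> =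
      cscale (c3\<^sup>2 - c1\<^sup>2 - c2\<^sup>2 - 1/2) \<psi>"
    using st by (simp add: cas_insert cas_singleton Cas assms(1)) (simp add: fun_eq_iff algebra_simps)
  moreover have "gop d Edge1 (gop d Edge2 \<psi>) + gop d Edge2 (gop d Edge1 \<psi>) =
     cscale (1 / (c1 * c2)) ((dot d Fermion Edge1 (dot d Fermion Edge2 \<psi>) + dot d Fermion Edge2 (dot d Fermion Edge1 \<psi>))
       + dot d Fermion Edge1 \<psi> + dot d Fermion Edge2 \<psi> + cscale (1/2) \<psi>)"
    unfolding gop_def c1_def[symmetric] c2_def[symmetric]
    by (simp add: dot_add dot_scale) (simp add: fun_eq_iff algebra_simps)
  moreover have "dot d Fermion Edge1 (dot d Fermion Edge2 \<psi>) + dot d Fermion Edge2 (dot d Fermion Edge1 \<psi>) = dot d Edge1 Edge2 \<psi>"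
    by (rule dot_fermion_anticommute[OF assms(1) st]) simp_all
  ultimately have "gop d Edge1 (gop d Edge2 \<psi>) + gop d Edge2 (gop d Edge1 \<psi>) =
     cscale (1 / (c1 * c2)) (cscale (c3\<^sup>2 - c1\<^sup>2 - c2\<^sup>2 - 1/2) \<psi> + cscale (1/2) \<psi>)"
    by (simp only:)
  also have "\<dots> = cscale ((c3\<^sup>2 - c1\<^sup>2 - c2\<^sup>2) / (c1 * c2)) \<psi>"
    by (simp add: fun_eq_iff algebra_simps add_divide_distrib diff_divide_distrib)
  finally show ?thesis by (simp add: c1_def c2_def c3_def)
qed


section \<open>The sign operators\<close>

text \<open>With c = \<open>J (d e)\<close> one has k + 1 = 2 c + r, so the Casimir value ((k + 1)^2
  - 1)/4 is c^2 + r c because r^2 = 1. By invariance it is also the value for the pair of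
  \<open>e\<close> and the fermion.\<close>

lemma gop_coupled:
  assumes "d Fermion = 1" "\<psi> \<in> intertwiners d" and ef: "- {e, Fermion} = {f, Edge3}" "e \<noteq> Fermion"
    and "\<psi> \<in> coupled d {f, Edge3} k" and k: "int k = int (d e) + r" "r \<in> {1, -1}"
  shows "gop d e \<psi> = cscale (of_int r) \<psi>"
proof -
  define c where "c = complex_of_real (J (d e))"
  have c: "c \<noteq> 0" using J_pos[of "d e"] by (simp add: c_def)
  have "complex_of_int (int k) = of_int (int (d e) + r)" by (simp only: k)
  then have kc: "of_nat k = 2 * c - 1 + of_int r" by (simp add: c_def J_def)
  have *: "of_nat k * (of_nat k + 2) / 4 = c\<^sup>2 + of_int r * c"
    unfolding kc using k(2) by (auto simp: power2_eq_square field_simps)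
  have "cas d {e, Fermion} \<psi> = cscale (c\<^sup>2 + of_int r * c) \<psi>"
    using coupled_cas[OF assms(5)] cas_complement[OF assms(2), of "{e, Fermion}"] unfolding ef * by simp
  then show ?thesis
    using c unfolding cas_fermion_pair[OF assms(1) intertwiners_states[OF assms(2)] ef(2)] c_def[symmetric]
    by (simp add: fun_eq_iff algebra_simps)
qed

text \<open>A nonzero entry has total magnetic number zero. The result supplies the parity for
  \<open>coupled_iff_cas\<close>.\<close>

lemma intertwiner_even:
  assumes "\<psi> \<in> intertwiners d" "\<psi> \<noteq> 0"
  shows "even (\<Sum>i\<in>UNIV. d i)"
proof -
  obtain m where m: "\<psi> m \<noteq> 0" using assms(2) by (auto simp: fun_eq_iff)
  have "tot d UNIV Zf \<psi> m = 0" using assms(1) by (simp add: intertwiners_iff)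
  then have "real (\<Sum>i\<in>UNIV. m i) - real (\<Sum>i\<in>UNIV. d i) / 2 = 0"
    using m unfolding tot_Z_apply[OF intertwiners_states[OF assms(1)]] by (simp del: of_nat_sum of_real_diff)
  then have "real (\<Sum>i\<in>UNIV. d i) = real (2 * (\<Sum>i\<in>UNIV. m i))" by (simp del: of_nat_sum)
  then have "(\<Sum>i\<in>UNIV. d i) = 2 * (\<Sum>i\<in>UNIV. m i)" unfolding of_nat_eq_iff .
  then show ?thesis by simp
qed

lemma dot_trivial:
  assumes "d e = 0" "i \<noteq> e"
  shows "dot d i e \<psi> = 0"
proof -
  have "legop d e N \<psi> = 0" if "N \<in> {Zf, Pf, Mf}" for N
    using that assms by (auto simp: legop_def fun_eq_iff Zf_def Pf_def Mf_def)
  then show ?thesis by (simp add: dot_def legop_0)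
qed

lemma gop_eigenvector_coupled:
  assumes "d Fermion = 1" "\<psi> \<in> intertwiners d" and ef: "- {e, Fermion} = {f, Edge3}" "e \<noteq> Fermion" "f \<noteq> Edge3"
    and g: "gop d e \<psi> = cscale (of_int r) \<psi>" and r: "r \<in> {1, -1}" and nz: "\<psi> \<noteq> 0"
  obtains k where "int k = int (d e) + r" "\<psi> \<in> coupled d {f, Edge3} k"
proof (cases "int (d e) + r \<ge> 0")
  case True
  then obtain k where k: "int k = int (d e) + r" by (metis nonneg_int_cases)
  define c where "c = complex_of_real (J (d e))"
  have "complex_of_int (int k) = of_int (int (d e) + r)" by (simp only: k)
  then have kc: "of_nat k = 2 * c - 1 + of_int r" by (simp add: c_def J_def)
  have *: "of_nat k * (of_nat k + 2) / 4 = c\<^sup>2 + of_int r * c"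
    unfolding kc using r by (auto simp: power2_eq_square field_simps)
  have "cas d {f, Edge3} \<psi> = cas d {e, Fermion} \<psi>"
    using cas_complement[OF assms(2), of "{e, Fermion}"] by (simp add: ef)
  then have "cas d {f, Edge3} \<psi> = cscale (of_nat k * (of_nat k + 2) / 4) \<psi>"
    unfolding cas_fermion_pair[OF assms(1) intertwiners_states[OF assms(2)] ef(2)] g * c_def[symmetric]
    by (simp add: fun_eq_iff algebra_simps)
  moreover have "even (k + (\<Sum>i\<in>{f, Edge3}. d i))"
  proof -
    have "(\<Sum>i\<in>UNIV. d i) = (\<Sum>i\<in>{e, Fermion}. d i) + (\<Sum>i\<in>{f, Edge3}. d i)"
      unfolding ef(1)[symmetric] by (subst sum.union_disjoint[symmetric]) auto
    then have "even (d e + 1 + (\<Sum>i\<in>{f, Edge3}. d i))"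
      using intertwiner_even[OF assms(2) nz] ef(2) assms(1) by simp
    moreover have "even (int k + int (d e + 1))" using k r by auto
    then have "even (k + (d e + 1))" by presburger
    ultimately show ?thesis by presburger
  qed
  ultimately have "\<psi> \<in> coupled d {f, Edge3} k"
    by (intro coupled_iff_cas intertwiners_states[OF assms(2)])
  with k that show ?thesis by blast
next
  case False
  \<comment> \<open>For a spin-0 edge \<open>gop\<close> is the identity, so the eigenvalue -1,
    which would call for k = -1, leaves only \<psi> = 0.\<close>
  then have "d e = 0" "r = -1" using r by auto
  then have "\<psi> = 0" using g ef(2) by (simp add: gop_def dot_trivial J_def) (simp add: fun_eq_iff)
  with nz show ?thesis by simp
qed

lemma coupled_single:
  assumes "\<psi> \<in> states d"
  shows "\<psi> \<in> coupled d {e} (d e)"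
  using assms by (intro coupled_iff_cas) (simp_all add: cas_singleton)

text \<open>\<open>is_sign_operator\<close> quantifies over all u and l; strict monotonicity of l(l
  + 2) fixes the spin on the side that has a single edge.\<close>

lemma coupled_single_spin:
  assumes "\<psi> \<in> coupled d {e} l" "\<psi> \<noteq> 0"
  shows "l = d e"
proof -
  obtain m where m: "\<psi> m \<noteq> 0" using assms(2) by (auto simp: fun_eq_iff)
  have "\<psi> \<in> states d" "cas d {e} \<psi> m = cscale (of_nat l * (of_nat l + 2) / 4) \<psi> m"
    using coupled_cas[OF assms(1)] by auto
  then have "of_nat (d e) * (of_nat (d e) + 2) / 4 * \<psi> m = of_nat l * (of_nat l + 2) / 4 * \<psi> m"
    by (simp only: cas_singleton cscale_apply)
  then have "of_nat (d e) * (of_nat (d e) + 2) / 4 = (of_nat l * (of_nat l + 2) / 4 :: complex)"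
    by (rule mult_right_cancel[OF m, THEN iffD1])
  then have "complex_of_nat (l * (l + 2)) = of_nat (d e * (d e + 2))"
    by (simp, simp add: algebra_simps)
  then have *: "l * (l + 2) = d e * (d e + 2)" unfolding of_nat_eq_iff .
  show ?thesis
  proof (rule ccontr)
    assume "l \<noteq> d e"
    then consider "l < d e" | "d e < l" by linarith
    then show False using * mult_strict_mono[of l "d e" "l + 2" "d e + 2"]
      mult_strict_mono[of "d e" l "d e + 2" "l + 2"] by cases auto
  qed
qed

text \<open>The value 0 off the intertwiners matches \<open>is_sign_operator\<close>, so
  \<open>sop\<close> can equal the definite description on all states.\<close>

definition sop :: "(leg \<Rightarrow> nat) \<Rightarrow> leg \<Rightarrow> int \<Rightarrow> state \<Rightarrow> state" where
  "sop d e s \<psi> = (if \<psi> \<in> intertwiners d then cscale (of_int s) (gop d e \<psi>) else 0)"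

text \<open>\<open>e\<close> is the edge alone on its side and \<open>f\<close> the one coupled with
  \<open>Edge3\<close>; \<open>s\<close> tells whether the lone edge is below (-1) or above (1).
  Uniqueness holds because eigenvectors of the involution \<open>gop\<close> span the intertwiners
  and are coupled.\<close>

lemma sign_operator_eqI:
  assumes F: "d Fermion = 1" and ef: "- {e, Fermion} = {f, Edge3}" "e \<noteq> Fermion" "f \<noteq> Edge3"
    and S: "(above S = {f, Edge3} \<and> below S = {e} \<and> s = -1) \<or> (above S = {e} \<and> below S = {f, Edge3} \<and> s = 1)"
  shows "sign_operator d S = sop d e s"
proof -
  have s: "s \<in> {1, -1}" using S by auto
  have gop: "gop d e \<psi> \<in> intertwiners d" if "\<psi> \<in> intertwiners d" for \<psi>
    using gop_intertwiners F ef(2) that by blast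
  have on: "sop d e s \<psi> = cscale (of_int s) (gop d e \<psi>)" if "\<psi> \<in> intertwiners d" for \<psi>
    using that by (simp add: sop_def)
  have eig: "sop d e s \<psi> = cscale (of_int p) \<psi>"
    if \<psi>: "\<psi> \<in> intertwiners d" "\<psi> \<in> coupled d (above S) u" "\<psi> \<in> coupled d (below S) l"
      and p: "p \<in> {1, -1}" "int l = int u + p" for \<psi> u l p
  proof (cases "\<psi> = 0")
    case True
    have "gop d e 0 = 0" using gop_scale[of d e 0 0] by simp
    then show ?thesis by (simp add: True sop_def intertwiners_0)
  next
    case False
    from S show ?thesis
    proof (elim disjE conjE)
      assume S: "above S = {f, Edge3}" "below S = {e}" "s = -1"
      have "l = d e" using coupled_single_spin[of \<psi> d e l] \<psi> S False by simp
      then have "gop d e \<psi> = cscale (of_int (- p)) \<psi>"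
        using \<psi> S p by (intro gop_coupled[OF F \<psi>(1) ef(1,2)]) auto
      then show ?thesis using \<psi>(1) S by (simp add: sop_def)
    next
      assume S: "above S = {e}" "below S = {f, Edge3}" "s = 1"
      have "u = d e" using coupled_single_spin[of \<psi> d e u] \<psi> S False by simp
      then have "gop d e \<psi> = cscale (of_int p) \<psi>"
        using \<psi> S p by (intro gop_coupled[OF F \<psi>(1) ef(1,2)]) auto
      then show ?thesis using \<psi>(1) S by (simp add: sop_def)
    qed
  qed
  have sop: "is_sign_operator d S (sop d e s)"
    unfolding is_sign_operator_def
  proof (intro conjI ballI allI impI)
    show "sop d e s \<psi> \<in> intertwiners d" if "\<psi> \<in> intertwiners d" for \<psi>
      using that by (simp add: on gop intertwiners_scale)
    show "sop d e s \<psi> = 0" if "\<psi> \<notin> intertwiners d" for \<psi>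
      using that by (simp add: sop_def)
    show "sop d e s (\<phi> + \<psi>) = sop d e s \<phi> + sop d e s \<psi>"
      if "\<phi> \<in> intertwiners d" "\<psi> \<in> intertwiners d" for \<phi> \<psi>
      using that by (simp add: on gop_add intertwiners_add cfun.scale_right_distrib)
    show "sop d e s (cscale c \<psi>) = cscale c (sop d e s \<psi>)" if "\<psi> \<in> intertwiners d" for c \<psi>
      using that by (simp add: on gop_scale intertwiners_scale mult.commute)
    show "cinner (configs d) \<phi> (sop d e s \<psi>) = cinner (configs d) (sop d e s \<phi>) \<psi>"
      if "\<phi> \<in> intertwiners d" "\<psi> \<in> intertwiners d" for \<phi> \<psi>
      using that gop_selfadjoint[of d \<psi> \<phi> e] F ef(2)
      by (simp add: on cinner_scale_left cinner_scale_right intertwiners_states)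
  qed (use eig in auto)
  show ?thesis
    unfolding sign_operator_def
  proof (rule the_equality)
    show "is_sign_operator d S (sop d e s)" by (rule sop)
  next
    fix A assume A: "is_sign_operator d S A"
    have A0: "A 0 = 0"
    proof -
      have "A (cscale 0 0) = cscale 0 (A 0)"
        using A intertwiners_0[of d] unfolding is_sign_operator_def by blast
      then show ?thesis by simp
    qed
    have part: "A \<psi> = sop d e s \<psi>"
      if \<psi>: "\<psi> \<in> intertwiners d" and g: "gop d e \<psi> = cscale (of_int r) \<psi>" and r: "r \<in> {1, -1}" for \<psi> r
    proof (cases "\<psi> = 0")
      case True
      then show ?thesis using g by (simp add: A0 sop_def)
    next
      case False
      then obtain k where k: "int k = int (d e) + r" "\<psi> \<in> coupled d {f, Edge3} k"
        using gop_eigenvector_coupled[OF F \<psi> ef g r] by blast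
      have e: "\<psi> \<in> coupled d {e} (d e)" by (rule coupled_single[OF intertwiners_states[OF \<psi>]])
      have sr: "s * r \<in> {1, -1}" using s r by auto
      have "A \<psi> = cscale (of_int (s * r)) \<psi>"
        using S
      proof (elim disjE conjE)
        assume S: "above S = {f, Edge3}" "below S = {e}" "s = -1"
        then have "int (d e) = int k + s * r" using k by simp
        then show ?thesis
          using A k(2) e \<psi> sr unfolding is_sign_operator_def S by blast
      next
        assume S: "above S = {e}" "below S = {f, Edge3}" "s = 1"
        then have "int k = int (d e) + s * r" using k by simp
        then show ?thesis
          using A k(2) e \<psi> sr unfolding is_sign_operator_def S by blast
      qed
      then show ?thesis using \<psi> g by (simp add: on)
    qed
    show "A = sop d e s"
    proof
      fix \<psi>
      show "A \<psi> = sop d e s \<psi>"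
      proof (cases "\<psi> \<in> intertwiners d")
        case False
        then show ?thesis using A by (simp add: is_sign_operator_def sop_def)
      next
        case True
        \<comment> \<open>The spectral projections (1 + r \<open>gop\<close>)/2 of the involution,
          for r = 1 and -1.\<close>
        define \<phi> where "\<phi> r = cscale (1/2) (\<psi> + cscale (of_int r) (gop d e \<psi>))" for r
        have \<phi>: "\<phi> r \<in> intertwiners d" for r
          using True by (simp add: \<phi>_def intertwiners_add intertwiners_scale gop)
        have g: "gop d e (\<phi> r) = cscale (of_int r) (\<phi> r)" if "r \<in> {1, -1}" for r
          using that gop_square[OF F intertwiners_states[OF True] ef(2)]
          by (auto simp: \<phi>_def gop_add gop_scale) (auto simp: fun_eq_iff algebra_simps)
        have \<psi>: "\<psi> = \<phi> 1 + \<phi> (-1)" by (simp add: \<phi>_def fun_eq_iff algebra_simps)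
        have "A \<psi> = A (\<phi> 1) + A (\<phi> (-1))"
          using A \<phi> \<psi> unfolding is_sign_operator_def by metis
        also have "\<dots> = sop d e s (\<phi> 1) + sop d e s (\<phi> (-1))"
          using part[OF \<phi> g] by simp
        also have "\<dots> = sop d e s (\<phi> 1 + \<phi> (-1))"
          by (simp add: on \<phi> intertwiners_add gop_add cfun.scale_right_distrib)
        also have "\<dots> = sop d e s \<psi>" by (simp only: \<psi>[symmetric])
        finally show ?thesis .
      qed
    qed
  qed
qed

lemma sign_operator_S0: "d Fermion = 1 \<Longrightarrow> sign_operator d S0 = sop d Edge2 (-1)"
  by (rule sign_operator_eqI[where f = Edge1]) (use UNIV_leg in auto)

lemma sign_operator_S1: "d Fermion = 1 \<Longrightarrow> sign_operator d S1 = sop d Edge1 1"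
  by (rule sign_operator_eqI[where f = Edge2]) (use UNIV_leg in auto)


section \<open>The CHSH operator\<close>

lemma intertwiner_vanishes:
  assumes \<psi>: "\<psi> \<in> intertwiners d" and sum: "d i = (\<Sum>j\<in>- {i}. d j)" and 0: "\<psi> (d(i := 0)) = 0"
  shows "\<psi> = 0"
proof -
  have st: "\<psi> \<in> states d" by (rule intertwiners_states[OF \<psi>])
  have U: "(\<Sum>j\<in>UNIV. f j) = f i + (\<Sum>j\<in>- {i}. f j)" for f :: "leg \<Rightarrow> nat"
    unfolding Compl_eq_Diff_UNIV by (rule sum.remove) auto
  have "\<psi> m = 0" if "m \<in> configs d" "m i = r" for m r
    using that
  proof (induction r arbitrary: m)
    case 0
    \<comment> \<open>With leg i at its lowest index, vanishing total J_z forces every other leg to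
      its top index, leaving the configuration d(i := 0).\<close>
    show ?case
    proof (rule ccontr)
      assume nz: "\<psi> m \<noteq> 0"
      have "tot d UNIV Zf \<psi> m = 0" using \<psi> by (simp add: intertwiners_iff)
      then have "real (\<Sum>i\<in>UNIV. m i) - real (\<Sum>i\<in>UNIV. d i) / 2 = 0"
        using nz unfolding tot_Z_apply[OF st] by (simp del: of_nat_sum of_real_diff)
      then have "real (\<Sum>j\<in>- {i}. m j) = real (\<Sum>j\<in>- {i}. d j)"
        unfolding U sum using 0 by (simp del: of_nat_sum)
      then have "(\<Sum>j\<in>- {i}. m j) = (\<Sum>j\<in>- {i}. d j)" unfolding of_nat_eq_iff .
      then have "m j = d j" if "j \<in> - {i}" for j
        using sum_mono_inv[of m "- {i}" d] 0 that by (simp add: configs_def)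
      then have "m = d(i := 0)" using 0 by (intro ext) auto
      then show False using nz assms(3) by simp
    qed
  next
    case (Suc r)
    \<comment> \<open>In the entry of J_- \<psi> = 0 at m', lowering on another leg keeps leg i at
      r, where \<psi> vanishes by induction; only the term with \<psi> m survives.\<close>
    define m' where "m' = m(i := r)"
    have r: "Suc r \<le> d i" using Suc.prems configs_le[of m d i] by simp
    have m': "m' \<in> configs d" "m' i = r" "m'(i := Suc r) = m"
      using Suc.prems r by (auto simp: m'_def intro!: configs_upd)
    have "legop d j Mf \<psi> m' = 0" if "j \<noteq> i" for j
    proof -
      have "\<psi> (m'(j := c)) = 0" if "c \<le> d j" for c
        by (rule Suc.IH[OF configs_upd[OF m'(1) that]]) (use m'(2) \<open>j \<noteq> i\<close> in simp)
      then show ?thesis by (simp add: legop_def)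
    qed
    then have "tot d UNIV Mf \<psi> m' = legop d i Mf \<psi> m'"
      unfolding tot_def sum_fun_apply by (simp add: sum.remove[of UNIV i])
    then have "legop d i Mf \<psi> m' = 0" using \<psi> by (simp add: intertwiners_iff)
    moreover have "legop d i Mf \<psi> m' = (\<Sum>c\<le>d i. if c = Suc r then Mf (d i) r (Suc r) * \<psi> m else 0)"
    proof -
      have "(\<Sum>c\<le>d i. Mf (d i) r c * \<psi> (m'(i := c))) =
          (\<Sum>c\<le>d i. if c = Suc r then Mf (d i) r (Suc r) * \<psi> m else 0)"
        by (intro sum.cong refl) (auto simp: Mf_def m'(3))
      then show ?thesis using r by (simp add: legop_def m'(2))
    qed
    ultimately have "Mf (d i) r (Suc r) * \<psi> m = 0" using r by simp
    moreover have "Mf (d i) r (Suc r) \<noteq> 0" using r by (simp add: Mf_def)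
    ultimately show ?case by simp
  qed
  then show ?thesis using st by (auto simp: states_def fun_eq_iff)
qed

text \<open>By \<open>intertwiner_vanishes\<close>, evaluation at d(i := 0) is an injective linear
  functional on the intertwiners.\<close>

lemma dim_intertwiners_le_1:
  assumes "d i = (\<Sum>j\<in>- {i}. d j)"
  shows "cfun.dim (intertwiners d) \<le> 1"
proof (cases "intertwiners d \<subseteq> {0}")
  case True
  then show ?thesis using cfun.dim_le_card[of "intertwiners d" "{}"] by simp
next
  case False
  then obtain \<phi> where \<phi>: "\<phi> \<in> intertwiners d" "\<phi> \<noteq> 0" by auto
  define m where "m = d(i := 0)"
  have nz: "\<phi> m \<noteq> 0" using intertwiner_vanishes[OF \<phi>(1) assms] \<phi>(2) by (auto simp: m_def)
  have "\<psi> \<in> cfun.span {\<phi>}" if \<psi>: "\<psi> \<in> intertwiners d" for \<psi>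
  proof -
    define q where "q = \<psi> m / \<phi> m"
    have "(\<psi> + cscale (- q) \<phi>) m = 0" using nz by (simp add: q_def)
    then have "\<psi> + cscale (- q) \<phi> = 0"
      using \<psi> \<phi>(1) unfolding m_def
      by (intro intertwiner_vanishes[OF _ assms] intertwiners_add intertwiners_scale)
    then have "\<psi> = cscale q \<phi>" by (simp add: add_eq_0_iff2)
    then show ?thesis by (metis cfun.span_base cfun.span_scale insertI1)
  qed
  then have "cfun.dim (intertwiners d) \<le> card {\<phi>}" by (intro cfun.dim_le_card) auto
  then show ?thesis by simp
qed

lemma sin_nonzero:
  assumes "d Fermion = 1" "cfun.dim (intertwiners d) = 2"
    and "cos \<alpha> = ((J (d Edge1))\<^sup>2 + (J (d Edge2))\<^sup>2 - (J (d Edge3))\<^sup>2) / (2 * J (d Edge1) * J (d Edge2))"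
  shows "sin \<alpha> \<noteq> 0"
proof
  assume "sin \<alpha> = 0"
  then have "(cos \<alpha>)\<^sup>2 = 1" using sin_cos_squared_add[of \<alpha>] by simp
  have J3: "(J (d Edge3))\<^sup>2 = (J (d Edge1))\<^sup>2 + (J (d Edge2))\<^sup>2 - cos \<alpha> * (2 * J (d Edge1) * J (d Edge2))"
    unfolding assms(3) using J_pos[of "d Edge1"] J_pos[of "d Edge2"] by simp
  from \<open>(cos \<alpha>)\<^sup>2 = 1\<close> consider "cos \<alpha> = 1" | "cos \<alpha> = -1" by (auto simp: power2_eq_1_iff)
  then have "J (d Edge3) = J (d Edge1) - J (d Edge2) \<or> J (d Edge3) = J (d Edge2) - J (d Edge1)
    \<or> J (d Edge3) = J (d Edge1) + J (d Edge2)"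
  proof cases
    case 1
    then have "(J (d Edge3))\<^sup>2 = (J (d Edge1) - J (d Edge2))\<^sup>2"
      using J3 by (simp add: power2_diff)
    then show ?thesis unfolding power2_eq_iff by auto
  next
    case 2
    then have "(J (d Edge3))\<^sup>2 = (J (d Edge1) + J (d Edge2))\<^sup>2"
      using J3 by (simp add: power2_sum)
    then show ?thesis
      using J_pos[of "d Edge1"] J_pos[of "d Edge2"] J_pos[of "d Edge3"] unfolding power2_eq_iff by auto
  qed
  \<comment> \<open>The offsets 1/2 in the three \<open>J\<close> leave a net 1, the doubled spin of
    the fermion.\<close>
  then have "real (d Edge1) = real (d Edge2 + d Edge3 + 1) \<or> real (d Edge2) = real (d Edge1 + d Edge3 + 1)
    \<or> real (d Edge3) = real (d Edge1 + d Edge2 + 1)"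
    by (auto simp: J_def)
  then have "d Edge1 = d Edge2 + d Edge3 + 1 \<or> d Edge2 = d Edge1 + d Edge3 + 1
    \<or> d Edge3 = d Edge1 + d Edge2 + 1"
    unfolding of_nat_eq_iff .
  moreover have "- {Edge1} = {Edge2, Edge3, Fermion}" "- {Edge2} = {Edge1, Edge3, Fermion}"
    "- {Edge3} = {Edge1, Edge2, Fermion}" using UNIV_leg by auto
  then have "(\<Sum>j\<in>- {Edge1}. d j) = d Edge2 + d Edge3 + 1" "(\<Sum>j\<in>- {Edge2}. d j) = d Edge1 + d Edge3 + 1"
    "(\<Sum>j\<in>- {Edge3}. d j) = d Edge1 + d Edge2 + 1"
    using assms(1) by simp_all
  ultimately have "\<exists>i. d i = (\<Sum>j\<in>- {i}. d j)" by metis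
  then show False using dim_intertwiners_le_1[of d] assms(2) by auto
qed

section \<open>The two involutions at one vertex\<close>

lemma sop_linear:
  assumes "\<phi> \<in> intertwiners d" "\<psi> \<in> intertwiners d"
  shows "sop d e s (cscale a \<phi> + cscale b \<psi>) = cscale a (sop d e s \<phi>) + cscale b (sop d e s \<psi>)"
  using assms by (simp add: sop_def intertwiners_add intertwiners_scale gop_add gop_scale)
    (simp add: fun_eq_iff algebra_simps)

lemma intertwiners_minus: "\<psi> \<in> intertwiners d \<Longrightarrow> - \<psi> \<in> intertwiners d"
  using intertwiners_scale[of \<psi> d "-1"] by simp

lemma gop_minus: "gop d e (- \<psi>) = - gop d e \<psi>"
  using gop_scale[of d e "-1" \<psi>] by simp

text \<open>The operator \<open>A\<^sub>0 A\<^sub>1\<close> is unitary with eigenvalues \<open>c \<plusminus> \<i> s\<close>, where \<open>c = cos \<alpha>\<close> and \<open>s = \<bar>sin \<alpha>\<bar>\<close>,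
  and \<open>A\<^sub>0\<close> exchanges its two eigenspaces.\<close>

lemma vertex_basis:
  assumes F: "d Fermion = 1" and dim: "cfun.dim (intertwiners d) = 2"
    and cos: "cos \<alpha> = ((J (d Edge1))\<^sup>2 + (J (d Edge2))\<^sup>2 - (J (d Edge3))\<^sup>2) / (2 * J (d Edge1) * J (d Edge2))"
  defines "\<omega> \<equiv> Complex (cos \<alpha>) \<bar>sin \<alpha>\<bar>"
  obtains \<phi> \<eta> where "\<phi> \<in> intertwiners d" "\<eta> \<in> intertwiners d" "\<phi> \<noteq> 0"
    "sign_operator d S0 \<phi> = \<eta>" "sign_operator d S0 \<eta> = \<phi>"
    "sign_operator d S1 \<phi> = cscale \<omega> \<eta>" "sign_operator d S1 \<eta> = cscale (cnj \<omega>) \<phi>"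
proof -
  define A where "A = sop d Edge2 (-1)"
  define B where "B = sop d Edge1 1"
  have A_lin: "A (cscale a \<phi> + cscale b \<psi>) = cscale a (A \<phi>) + cscale b (A \<psi>)"
    and B_lin: "B (cscale a \<phi> + cscale b \<psi>) = cscale a (B \<phi>) + cscale b (B \<psi>)"
    if "\<phi> \<in> intertwiners d" "\<psi> \<in> intertwiners d" for a b \<phi> \<psi>
    using that by (simp_all only: A_def B_def sop_linear)
  have A_scale: "A (cscale a \<phi>) = cscale a (A \<phi>)" and B_scale: "B (cscale a \<phi>) = cscale a (B \<phi>)"
    if "\<phi> \<in> intertwiners d" for a \<phi>
    using A_lin[of \<phi> \<phi> a 0] B_lin[of \<phi> \<phi> a 0] that by simp_all
  have A_in: "A \<phi> \<in> intertwiners d" and B_in: "B \<phi> \<in> intertwiners d" if "\<phi> \<in> intertwiners d" for \<phi>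
    using that F by (simp_all add: A_def B_def sop_def intertwiners_scale intertwiners_minus gop_minus gop_intertwiners)
  have AA: "A (A \<phi>) = \<phi>" and BB: "B (B \<phi>) = \<phi>" if "\<phi> \<in> intertwiners d" for \<phi>
    using that F by (simp_all add: A_def B_def sop_def intertwiners_scale intertwiners_minus gop_minus gop_intertwiners gop_scale
        gop_square intertwiners_states)
  have AB: "A (B \<phi>) + B (A \<phi>) = cscale (2 * of_real (cos \<alpha>)) \<phi>" if \<phi>: "\<phi> \<in> intertwiners d" for \<phi>
  proof -
    have "A (B \<phi>) + B (A \<phi>) = cscale (-1) (gop d Edge1 (gop d Edge2 \<phi>) + gop d Edge2 (gop d Edge1 \<phi>))"
      using \<phi> F by (simp add: A_def B_def sop_def intertwiners_scale intertwiners_minus gop_minus gop_intertwiners gop_scale)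
    also have "\<dots> = cscale (2 * of_real (cos \<alpha>)) \<phi>"
      unfolding gop_anticommute[OF F \<phi>] cos using J_pos[of "d Edge1"] J_pos[of "d Edge2"]
      by (simp add: fun_eq_iff field_simps)
    finally show ?thesis .
  qed
  \<comment> \<open>\<omega> and its conjugate are the roots of x^2 - 2 x cos \<alpha> + 1, which
    annihilates A B.\<close>
  have \<omega>: "\<omega> * cnj \<omega> = 1" "\<omega> + cnj \<omega> = 2 * of_real (cos \<alpha>)"
    using sin_cos_squared_add2[of \<alpha>] by (simp_all add: \<omega>_def complex_eq_iff power2_eq_square)
  have "\<exists>\<phi>\<in>intertwiners d. \<phi> \<noteq> 0"
  proof (rule ccontr)
    assume "\<not> ?thesis"
    then have "intertwiners d \<subseteq> {0}" by auto
    then show False using cfun.dim_le_card[of "intertwiners d" "{}"] dim by simp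
  qed
  then obtain \<phi>0 where \<phi>0: "\<phi>0 \<in> intertwiners d" "\<phi>0 \<noteq> 0" by blast
  \<comment> \<open>If A B - cnj \<omega> does not kill \<phi>0, its image is an eigenvector for
    \<omega>. Otherwise \<phi>0 belongs to cnj \<omega>, and A maps it to the other
    eigenspace.\<close>
  obtain \<phi> where \<phi>: "\<phi> \<in> intertwiners d" "\<phi> \<noteq> 0" "A (B \<phi>) = cscale \<omega> \<phi>"
  proof (cases "A (B \<phi>0) = cscale (cnj \<omega>) \<phi>0")
    case True
    have "A (A \<phi>0) \<noteq> A 0"
      using \<phi>0 AA A_scale[of 0 0] by (simp add: intertwiners_0)
    then have nz: "A \<phi>0 \<noteq> 0" by auto
    have "cscale (cnj \<omega>) \<phi>0 + B (A \<phi>0) = cscale (\<omega> + cnj \<omega>) \<phi>0"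
      using AB[OF \<phi>0(1)] unfolding True \<omega>(2) .
    then have "B (A \<phi>0) = cscale \<omega> \<phi>0" by (simp add: cfun.scale_left_distrib)
    then have "A (B (A \<phi>0)) = cscale \<omega> (A \<phi>0)" using \<phi>0 by (simp add: A_scale)
    then show thesis using that nz A_in[OF \<phi>0(1)] by blast
  next
    case False
    define \<phi> where "\<phi> = cscale 1 (A (B \<phi>0)) + cscale (- cnj \<omega>) \<phi>0"
    have ABi: "A (B \<phi>0) \<in> intertwiners d" using A_in B_in \<phi>0 by blast
    have "\<phi> \<noteq> 0" using False by (simp add: \<phi>_def add_eq_0_iff2)
    moreover have "\<phi> \<in> intertwiners d"
      using ABi \<phi>0 unfolding \<phi>_def by (intro intertwiners_add intertwiners_scale) auto
    moreover have "A (B \<phi>) = cscale \<omega> \<phi>"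
    proof -
      have "A (B (B \<phi>0)) + B (A (B \<phi>0)) = cscale (\<omega> + cnj \<omega>) (B \<phi>0)"
        using AB[OF B_in[OF \<phi>0(1)]] unfolding \<omega>(2) .
      then have "B (A (B \<phi>0)) = cscale (\<omega> + cnj \<omega>) (B \<phi>0) + cscale (-1) (A \<phi>0)"
        using \<phi>0 by (simp add: BB eq_diff_eq add.commute)
      then have "A (B (A (B \<phi>0))) = cscale (\<omega> + cnj \<omega>) (A (B \<phi>0)) + cscale (-1) \<phi>0"
        using \<phi>0 by (simp only: A_lin A_in B_in AA)
      then have "A (B \<phi>) = cscale 1 (cscale (\<omega> + cnj \<omega>) (A (B \<phi>0)) + cscale (-1) \<phi>0) + cscale (- cnj \<omega>) (A (B \<phi>0))"
        unfolding \<phi>_def using \<phi>0 ABi by (simp only: A_lin B_lin A_in B_in)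
      also have "\<dots> = cscale \<omega> (A (B \<phi>0)) + cscale (- (\<omega> * cnj \<omega>)) \<phi>0"
        unfolding \<omega>(1) by (simp add: fun_eq_iff algebra_simps)
      also have "\<dots> = cscale \<omega> \<phi>" by (simp add: \<phi>_def fun_eq_iff algebra_simps)
      finally show ?thesis .
    qed
    ultimately show thesis using that by blast
  qed
  have "A (A (B \<phi>)) = cscale \<omega> (A \<phi>)" unfolding \<phi>(3) using \<phi> by (simp add: A_scale)
  then have 1: "B \<phi> = cscale \<omega> (A \<phi>)" using AA[OF B_in[OF \<phi>(1)]] by simp
  have "cscale \<omega> (B (A \<phi>)) = \<phi>"
    using BB[OF \<phi>(1)] unfolding 1 B_scale[OF A_in[OF \<phi>(1)]] .
  then have "cscale (cnj \<omega>) (cscale \<omega> (B (A \<phi>))) = cscale (cnj \<omega>) \<phi>" by (rule arg_cong)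
  then have "B (A \<phi>) = cscale (cnj \<omega>) \<phi>"
    by (simp only: cfun.scale_scale mult.commute[of "cnj \<omega>"] \<omega>(1) cfun.scale_one)
  moreover have "sign_operator d S0 = A" "sign_operator d S1 = B"
    using F by (simp_all add: A_def B_def sign_operator_S0 sign_operator_S1)
  ultimately show thesis
    using that[of \<phi> "A \<phi>"] \<phi> A_in[OF \<phi>(1)] AA[OF \<phi>(1)] 1 by simp
qed

section \<open>The two vertices together\<close>

lemma sign_operator_linear:
  assumes "d Fermion = 1" "\<phi> \<in> intertwiners d" "\<psi> \<in> intertwiners d"
  shows "sign_operator d S (cscale a \<phi> + cscale b \<psi>) =
    cscale a (sign_operator d S \<phi>) + cscale b (sign_operator d S \<psi>)"
  by (cases S) (simp_all only: sign_operator_S0 sign_operator_S1 assms sop_linear)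

text \<open>\<open>tensor_op\<close> applies its operators to slices, while the sign operators are
  linear on the intertwiners. For a two-term vector every slice lies in the span of \<phi>', \<eta>'
  or of \<phi>, \<eta>, so linearity there suffices.\<close>

lemma tensor_op_linear:
  assumes P: "\<And>a b. P (cscale a \<phi> + cscale b \<eta>) = cscale a (P \<phi>) + cscale b (P \<eta>)"
    and Q: "\<And>a b. Q (cscale a \<phi>' + cscale b \<eta>') = cscale a (Q \<phi>') + cscale b (Q \<eta>')"
  shows "tensor_op P Q (cscale x (product_state \<phi> \<phi>') + cscale y (product_state \<eta> \<eta>')) =
    cscale x (product_state (P \<phi>) (Q \<phi>')) + cscale y (product_state (P \<eta>) (Q \<eta>'))"
proof -
  have 1: "(\<lambda>k'. (cscale x (product_state \<phi> \<phi>') + cscale y (product_state \<eta> \<eta>')) (k, k')) =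
    cscale (x * \<phi> k) \<phi>' + cscale (y * \<eta> k) \<eta>'" for k
    by (simp add: fun_eq_iff product_state_def)
  have 2: "(\<lambda>k. (cscale (x * \<phi> k) (Q \<phi>') + cscale (y * \<eta> k) (Q \<eta>')) m') =
    cscale (x * Q \<phi>' m') \<phi> + cscale (y * Q \<eta>' m') \<eta>" for m'
    by (simp add: fun_eq_iff algebra_simps)
  show ?thesis
    unfolding tensor_op_def 1 Q 2 P by (auto simp: fun_eq_iff product_state_def algebra_simps)
qed

text \<open>For unit \<omega>, \<omega>' the number is (1 + \<omega>) + \<omega>' (1 - \<omega>).
  The squared moduli add up to 4, and the cross term is 4 s s' because (1 + \<omega>)(1 - cnj
  \<omega>) = 2 i s.\<close>

lemma cmod_chsh_value:
  assumes "c\<^sup>2 + s\<^sup>2 = 1" "c'\<^sup>2 + s'\<^sup>2 = 1"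
  shows "cmod (1 + Complex c s + Complex c' s' - Complex c s * Complex c' s') = 2 * sqrt (1 + s * s')"
proof -
  have c: "c * c = 1 - s * s" "c' * c' = 1 - s' * s'"
    using assms by (simp_all add: power2_eq_square)
  have c2: "c * (c * z) = (1 - s * s) * z" "c' * (c' * z) = (1 - s' * s') * z" for z
    by (simp_all flip: c)
  have "(1 + c + c' - (c * c' - s * s'))\<^sup>2 + (s + s' - (c * s' + s * c'))\<^sup>2 = 4 * (1 + s * s')"
    by (simp add: power2_eq_square algebra_simps c c2)
  then have "cmod (1 + Complex c s + Complex c' s' - Complex c s * Complex c' s') = sqrt (4 * (1 + s * s'))"
    by (simp add: cmod_def)
  then show ?thesis by (simp only: real_sqrt_mult real_sqrt_four)
qed

theorem chsh_eigenvector_exists: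
  assumes A: "dA Fermion = 1" "cfun.dim (intertwiners dA) = 2"
    "cos \<alpha>A = ((J (dA Edge1))\<^sup>2 + (J (dA Edge2))\<^sup>2 - (J (dA Edge3))\<^sup>2) / (2 * J (dA Edge1) * J (dA Edge2))"
    and B: "dB Fermion = 1" "cfun.dim (intertwiners dB) = 2"
    "cos \<alpha>B = ((J (dB Edge1))\<^sup>2 + (J (dB Edge2))\<^sup>2 - (J (dB Edge3))\<^sup>2) / (2 * J (dB Edge1) * J (dB Edge2))"
  shows "\<exists>\<mu> \<Psi>. chsh_eigenvector dA dB \<mu> \<Psi> \<and>
       cinner (configs dA \<times> configs dB) \<Psi> \<Psi> = 1 \<and>
       cmod \<mu> = 2 * sqrt (1 + \<bar>sin \<alpha>A\<bar> * \<bar>sin \<alpha>B\<bar>)"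
proof -
  define \<omega> where "\<omega> = Complex (cos \<alpha>A) \<bar>sin \<alpha>A\<bar>"
  define \<omega>' where "\<omega>' = Complex (cos \<alpha>B) \<bar>sin \<alpha>B\<bar>"
  obtain \<phi> \<eta> where a: "\<phi> \<in> intertwiners dA" "\<eta> \<in> intertwiners dA" "\<phi> \<noteq> 0"
    "sign_operator dA S0 \<phi> = \<eta>" "sign_operator dA S0 \<eta> = \<phi>"
    "sign_operator dA S1 \<phi> = cscale \<omega> \<eta>" "sign_operator dA S1 \<eta> = cscale (cnj \<omega>) \<phi>"
    using vertex_basis[OF A] unfolding \<omega>_def by blast
  obtain \<phi>' \<eta>' where b: "\<phi>' \<in> intertwiners dB" "\<eta>' \<in> intertwiners dB" "\<phi>' \<noteq> 0"
    "sign_operator dB S0 \<phi>' = \<eta>'" "sign_operator dB S0 \<eta>' = \<phi>'"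
    "sign_operator dB S1 \<phi>' = cscale \<omega>' \<eta>'" "sign_operator dB S1 \<eta>' = cscale (cnj \<omega>') \<phi>'"
    using vertex_basis[OF B] unfolding \<omega>'_def by blast
  \<comment> \<open>The four terms of the CHSH operator send \<phi> (x) \<phi>' to \<eta> (x)
    \<eta>' with the factors 1, \<omega>', \<omega> and -\<omega> \<omega>'.\<close>
  define z where "z = 1 + \<omega> + \<omega>' - \<omega> * \<omega>'"
  define l where "l = cmod z"
  have l: "l = 2 * sqrt (1 + \<bar>sin \<alpha>A\<bar> * \<bar>sin \<alpha>B\<bar>)"
    unfolding l_def z_def \<omega>_def \<omega>'_def by (rule cmod_chsh_value) simp_all
  have "l > 0" unfolding l by (simp add: add_pos_nonneg)
  have zl: "cnj z * z = of_real l * of_real l"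
    by (simp add: l_def complex_norm_square[symmetric] mult.commute flip: power2_eq_square of_real_power)
  define \<Psi> where "\<Psi> x y = cscale x (product_state \<phi> \<phi>') + cscale y (product_state \<eta> \<eta>')" for x y
  have T: "tensor_op (sign_operator dA S) (sign_operator dB S') (\<Psi> x y) =
      cscale x (product_state (sign_operator dA S \<phi>) (sign_operator dB S' \<phi>'))
      + cscale y (product_state (sign_operator dA S \<eta>) (sign_operator dB S' \<eta>'))" for S S' x y
    unfolding \<Psi>_def
    by (rule tensor_op_linear; rule sign_operator_linear) (use a b A(1) B(1) in auto)
  have B: "chsh dA dB (\<Psi> x y) = \<Psi> (cnj z * y) (z * x)" for x y
    unfolding chsh_def T a b
    by (auto simp: fun_eq_iff \<Psi>_def product_state_def z_def algebra_simps)
  have st: "\<phi> \<in> states dA" "\<eta> \<in> states dA" "\<phi>' \<in> states dB" "\<eta>' \<in> states dB"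
    using a b by (simp_all add: intertwiners_states)
  \<comment> \<open>The candidates for \<epsilon> = 1 and -1 add up to 2 l \<phi> (x) \<phi>', which
    is nonzero, so at least one of them is nonzero.\<close>
  have "\<exists>\<epsilon> \<in> {1, -1}. \<Psi> (of_real l) (\<epsilon> * z) \<noteq> 0"
  proof (rule ccontr)
    assume "\<not> ?thesis"
    then have "\<Psi> (of_real l) z = 0" "\<Psi> (of_real l) (- z) = 0" by auto
    then have *: "\<Psi> (of_real l) z + \<Psi> (of_real l) (- z) = 0" by simp
    obtain m where "\<phi> m \<noteq> 0" using a(3) by (auto simp: fun_eq_iff)
    moreover obtain m' where "\<phi>' m' \<noteq> 0" using b(3) by (auto simp: fun_eq_iff)
    moreover have "of_real l * (\<phi> m * \<phi>' m') = 0"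
      using fun_cong[OF *, of "(m, m')"] by (simp add: \<Psi>_def product_state_def)
    ultimately show False using \<open>l > 0\<close> by simp
  qed
  then obtain \<epsilon> where \<epsilon>: "\<epsilon> \<in> {1, -1 :: complex}" "\<Psi> (of_real l) (\<epsilon> * z) \<noteq> 0" by blast
  define \<Phi> where "\<Phi> = \<Psi> (of_real l) (\<epsilon> * z)"
  define N where "N = (\<Sum>p\<in>configs dA \<times> configs dB. (cmod (\<Phi> p))\<^sup>2)"
  have N: "cinner (configs dA \<times> configs dB) \<Phi> \<Phi> = of_real N"
    by (simp only: cinner_self N_def)
  have "N \<noteq> 0"
  proof
    assume "N = 0"
    have z: "\<Phi> (m, m') = 0" if "m \<notin> configs dA \<or> m' \<notin> configs dB" for m m'
      using st that by (auto simp: \<Phi>_def \<Psi>_def product_state_def states_def)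
    have "\<Phi> p = 0" if "p \<notin> configs dA \<times> configs dB" for p
      using that z[of "fst p" "snd p"] by (cases p) auto
    then have "\<Phi> = 0"
      using N \<open>N = 0\<close> by (intro cinner_self_eq_0[of "configs dA \<times> configs dB"]) auto
    then show False using \<epsilon>(2) by (simp add: \<Phi>_def)
  qed
  then have "N > 0" by (simp add: N_def less_le sum_nonneg)
  define r where "r = complex_of_real (1 / sqrt N)"
  have r: "r \<noteq> 0" "cnj r * (r * of_real N) = 1"
    using \<open>N > 0\<close> by (simp_all add: r_def flip: of_real_mult)
  have \<Phi>r: "cscale r \<Phi> = \<Psi> (r * of_real l) (r * (\<epsilon> * z))"
    by (simp add: \<Phi>_def \<Psi>_def cfun.scale_right_distrib)
  have "chsh dA dB (cscale r \<Phi>) = cscale (\<epsilon> * of_real l) (cscale r \<Phi>)"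
  proof -
    \<comment> \<open>By \<open>zl\<close> and \<epsilon>^2 = 1, the exchanged coefficients are
      \<epsilon> l times the original ones.\<close>
    have "cnj z * (r * (\<epsilon> * z)) = r * \<epsilon> * (cnj z * z)" by (simp add: mult_ac)
    then have 1: "cnj z * (r * (\<epsilon> * z)) = \<epsilon> * of_real l * (r * of_real l)"
      unfolding zl by (simp add: mult_ac)
    have 2: "z * (r * of_real l) = \<epsilon> * of_real l * (r * (\<epsilon> * z))"
      using \<epsilon>(1) by auto
    show ?thesis
      unfolding \<Phi>r B by (simp only: \<Psi>_def cfun.scale_right_distrib cfun.scale_scale 1 2)
  qed
  moreover have "cscale r \<Phi> \<in> tensor_space (intertwiners dA) (intertwiners dB)"
    unfolding \<Phi>r \<Psi>_def tensor_space_def using a b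
    by (intro cfun.span_add cfun.span_scale cfun.span_base) blast+
  moreover have "cscale r \<Phi> \<noteq> 0" using r \<epsilon>(2) by (simp add: \<Phi>_def)
  moreover have "cinner (configs dA \<times> configs dB) (cscale r \<Phi>) (cscale r \<Phi>) = 1"
    using r(2) by (simp add: cinner_scale_left cinner_scale_right N mult.left_commute)
  moreover have "cmod (\<epsilon> * of_real l) = l" using \<epsilon>(1) \<open>l > 0\<close> by (auto simp: norm_mult)
  ultimately show ?thesis
    unfolding chsh_eigenvector_def l[symmetric] by blast
qed

theorem mainTheorem4:
  fixes dA dB :: "leg \<Rightarrow> nat" and \<alpha>A \<alpha>B :: real
  assumes "dA Fermion = 1" and "dB Fermion = 1"
    and "cfun.dim (intertwiners dA) = 2" and "cfun.dim (intertwiners dB) = 2"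
    and "cos \<alpha>A = ((J (dA Edge1))\<^sup>2 + (J (dA Edge2))\<^sup>2 - (J (dA Edge3))\<^sup>2)
                    / (2 * J (dA Edge1) * J (dA Edge2))"
    and "cos \<alpha>B = ((J (dB Edge1))\<^sup>2 + (J (dB Edge2))\<^sup>2 - (J (dB Edge3))\<^sup>2)
                    / (2 * J (dB Edge1) * J (dB Edge2))"
  shows "2 * sqrt (1 + \<bar>sin \<alpha>A\<bar> * \<bar>sin \<alpha>B\<bar>) \<ge> 2 \<and>
    (\<exists>\<mu> \<Psi>. chsh_eigenvector dA dB \<mu> \<Psi> \<and>
       cinner (configs dA \<times> configs dB) \<Psi> \<Psi> = 1 \<and>
       cmod \<mu> = 2 * sqrt (1 + \<bar>sin \<alpha>A\<bar> * \<bar>sin \<alpha>B\<bar>)) \<and>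
    (\<forall>\<mu> \<Psi>. chsh_eigenvector dA dB \<mu> \<Psi> \<and>
       cinner (configs dA \<times> configs dB) \<Psi> \<Psi> = 1 \<and>
       cmod \<mu> = 2 * sqrt (1 + \<bar>sin \<alpha>A\<bar> * \<bar>sin \<alpha>B\<bar>) \<longrightarrow>
       cmod (cinner (configs dA \<times> configs dB) \<Psi> (chsh dA dB \<Psi>)) = cmod \<mu> \<and>
       cmod \<mu> > 2)"
proof (intro conjI)
  \<comment> \<open>The strict bound comes from dimension two, which excludes a vanishing sine at
    either vertex.\<close>
  have "\<bar>sin \<alpha>A\<bar> * \<bar>sin \<alpha>B\<bar> > 0"
    using sin_nonzero[OF assms(1,3,5)] sin_nonzero[OF assms(2,4,6)] by simp
  then have gt: "2 * sqrt (1 + \<bar>sin \<alpha>A\<bar> * \<bar>sin \<alpha>B\<bar>) > 2" by simp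
  then show "2 * sqrt (1 + \<bar>sin \<alpha>A\<bar> * \<bar>sin \<alpha>B\<bar>) \<ge> 2" by simp
  show "\<exists>\<mu> \<Psi>. chsh_eigenvector dA dB \<mu> \<Psi> \<and>
       cinner (configs dA \<times> configs dB) \<Psi> \<Psi> = 1 \<and>
       cmod \<mu> = 2 * sqrt (1 + \<bar>sin \<alpha>A\<bar> * \<bar>sin \<alpha>B\<bar>)"
    by (rule chsh_eigenvector_exists) (use assms in auto)
  \<comment> \<open>In a normalized eigenvector the expectation value is \<mu> itself.\<close>
  show "\<forall>\<mu> \<Psi>. chsh_eigenvector dA dB \<mu> \<Psi> \<and>
       cinner (configs dA \<times> configs dB) \<Psi> \<Psi> = 1 \<and>
       cmod \<mu> = 2 * sqrt (1 + \<bar>sin \<alpha>A\<bar> * \<bar>sin \<alpha>B\<bar>) \<longrightarrow>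
       cmod (cinner (configs dA \<times> configs dB) \<Psi> (chsh dA dB \<Psi>)) = cmod \<mu> \<and>
       cmod \<mu> > 2"
    using gt by (auto simp: chsh_eigenvector_def cinner_scale_right)
qed

end
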